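(* Let $n,k$ be positive integers with $n\ge\binom{k+1}{2}$. The intersection $NG_1(n,k)\cap NG_2(n,k)$ is an amphora in $S\text{-}Block(n)$, consisting of exactly those $S$-blocks in $S\text{-}Block(n)$ that majorize $[\tau_k(n)|\tau'_k(n)]$ and are majorized by some $S$-block $[\alpha|\beta]$ for which $\alpha,\beta\in Dis_k(n)$, the last part of $\alpha$ is at least $2$, the last part of $\beta$ equals $1$, and $\beta\gtrdot\alpha$.
   Context: $Dis(n)$ is the set of partitions $\gamma=(g_1,\dots,g_r)$ of $n$ into distinct positive parts $g_1>\dots>g_r>0$, with $\mathrm{len}(\gamma)=r$ and last part $g_r$; $Dis_k(n)$ is the subset of those with exactly $k$ parts. For $\gamma=(g_1,\dots,g_r)$ and $\delta=(d_1,\dots,d_s)$ in $Dis(n)$, $\delta\succeq\gamma$ ($\delta$ majorizes $\gamma$) means $\sum_{i=1}^m d_i\ge\sum_{i=1}^m g_i$ for all $m\le\min\{r,s\}$; $\beta\gtrdot\alpha$ means that $\beta$ covers $\alpha$ in the poset $Dis(n)$. An $S$-block is an ordered pair $[\alpha|\beta]$ with $\alpha,\beta\in Dis(n)$, $\beta\succeq\alpha$, and $\mathrm{len}(\alpha)\in\{\mathrm{len}(\beta),\mathrm{len}(\beta)+1\}$. $S\text{-}Block(n)$ is the poset of all such $S$-blocks, where $[\alpha_1|\beta_1]$ majorizes $[\alpha_2|\beta_2]$, written $[\alpha_1|\beta_1]\succeq[\alpha_2|\beta_2]$, iff $\alpha_1\succeq\alpha_2$ and $\beta_1\preceq\beta_2$.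 $A(n,k)$ is the subposet of $S$-blocks $[\alpha|\beta]$ with $\alpha,\beta\in Dis_k(n)$. For $n\ge\binom{k+1}{2}$, $\tau'_k(n)=(n-\binom k2,k-1,k-2,\dots,2,1)$; and, writing $n-\binom{k+1}{2}=qk+r$ with $0\le r<k$, $\tau_k(n)$ is the partition whose $i$-th part is $\hat s_i+(k-i+1)$, where $\hat s_i=q+1$ for $1\le i\le r$ and $\hat s_i=q$ for $r<i\le k$. Graphs are finite and simple, without isolated vertices. For a degree sequence $\pi=(d_1\ge\dots\ge d_r)$, $\alpha(\pi)$ has $i$-th part $d_i-i+1$ for those $i$ with $d_i\ge i$, and $\beta(\pi)$ has $j$-th part $|\{i:d_i\ge j\}|-j$ for those $j$ for which this is positive. A graph $G$ is an NG-graph if $\chi(G)+\chi(\overline G)=|V(G)|+1$. With $A_G=\{v:\deg(v)=\chi(G)-1\}$, an NG-graph is NG-1 if $G[A_G]$ is a clique and NG-2 if $G[A_G]$ is a stable set. An $S$-block $[\alpha|\beta]$ is called NG-1 (resp. NG-2) if there is an NG-1 (resp. NG-2) graph with degree sequence $\pi$ such that $\alpha=\alpha(\pi)$, $\beta=\beta(\pi)$. $NG_1(n,k)$ (resp. $NG_2(n,k)$) is the subposet of $A(n,k)$ consisting of its NG-1 (resp. NG-2) $S$-blocks. Given a poset $P$, a subposet $P'$ is an amphora if there exist an antichain $A$ in $P$ and an element $x$ less than or equal to every element of $A$ such that $P'$ consists of all elements of $P$ that are greater than or equal to $x$ and less than or equal to some element of $A$. The antichain $A$ may be empty, so the empty set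 counts as an amphora. *)

theory Defs
  imports Complex_Main "HOL-Library.Ramsey" "HOL-Library.Multiset"
begin

text \<open>Partitions are lists of positive parts in decreasing order; list index \<open>i\<close> holds the
  \<open>(i+1)\<close>-st part.\<close>

definition Dis :: "nat \<Rightarrow> nat list set" where
  "Dis n = {g. sorted_wrt (>) g \<and> (\<forall>x\<in>set g. 0 < x) \<and> sum_list g = n}"

definition Dis_len :: "nat \<Rightarrow> nat \<Rightarrow> nat list set" where
  "Dis_len k n = {g \<in> Dis n. length g = k}"

definition majorizes :: "nat list \<Rightarrow> nat list \<Rightarrow> bool" where
  "majorizes d g \<longleftrightarrow>
     (\<forall>m \<le> min (length g) (length d). sum_list (take m d) \<ge> sum_list (take m g))"

definition covers_Dis :: "nat \<Rightarrow> nat list \<Rightarrow> nat list \<Rightarrow> bool" where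
  "covers_Dis n b a \<longleftrightarrow>
     a \<in> Dis n \<and> b \<in> Dis n \<and> majorizes b a \<and> b \<noteq> a \<and>
     (\<forall>c \<in> Dis n. majorizes b c \<and> majorizes c a \<longrightarrow> c = a \<or> c = b)"

text \<open>An ordered pair \<open>(a, b)\<close> stands for \<open>[a|b]\<close>.\<close>

type_synonym block = "nat list \<times> nat list"

definition S_Block :: "nat \<Rightarrow> block set" where
  "S_Block n = {(a, b). a \<in> Dis n \<and> b \<in> Dis n \<and> majorizes b a \<and>
                  (length a = length b \<or> length a = length b + 1)}"

definition block_majorizes :: "block \<Rightarrow> block \<Rightarrow> bool" where
  "block_majorizes X Y \<longleftrightarrow> majorizes (fst X) (fst Y) \<and> majorizes (snd Y) (snd X)"

definition A_blocks :: "nat \<Rightarrow> nat \<Rightarrow> block set" where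
  "A_blocks n k = {(a, b) \<in> S_Block n. a \<in> Dis_len k n \<and> b \<in> Dis_len k n}"

definition tau' :: "nat \<Rightarrow> nat \<Rightarrow> nat list" where
  "tau' k n = (n - (k choose 2)) # rev [1..<k]"

definition tau :: "nat \<Rightarrow> nat \<Rightarrow> nat list" where
  "tau k n =
     (let q = (n - ((k + 1) choose 2)) div k; r = (n - ((k + 1) choose 2)) mod k
      in map (\<lambda>i. (if i \<le> r then q + 1 else q) + (k - i + 1)) [1..<k + 1])"

text \<open>A finite simple graph is a finite vertex set \<open>V\<close> with a set \<open>E\<close> of two-element subsets
  of \<open>V\<close>.  Cliques and stable sets are \<^const>\<open>clique\<close> and \<^const>\<open>indep\<close>.\<close>

definition simple_graph :: "'a set \<Rightarrow> 'a set set \<Rightarrow> bool" where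
  "simple_graph V E \<longleftrightarrow> finite V \<and> E \<subseteq> [V]\<^bsup>2\<^esup>"

definition degree :: "'a set set \<Rightarrow> 'a \<Rightarrow> nat" where
  "degree E v = card {e \<in> E. v \<in> e}"

definition no_isolated :: "'a set \<Rightarrow> 'a set set \<Rightarrow> bool" where
  "no_isolated V E \<longleftrightarrow> (\<forall>v\<in>V. degree E v > 0)"

definition complement_edges :: "'a set \<Rightarrow> 'a set set \<Rightarrow> 'a set set" where
  "complement_edges V E = [V]\<^bsup>2\<^esup> - E"

definition colorable :: "'a set \<Rightarrow> 'a set set \<Rightarrow> nat \<Rightarrow> bool" where
  "colorable V E c \<longleftrightarrow>
     (\<exists>f :: 'a \<Rightarrow> nat. f ` V \<subseteq> {..<c} \<and> (\<forall>u\<in>V. \<forall>v\<in>V. {u, v} \<in> E \<longrightarrow> f u \<noteq> f v))"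

definition chromatic_number :: "'a set \<Rightarrow> 'a set set \<Rightarrow> nat" where
  "chromatic_number V E = (LEAST c. colorable V E c)"

definition degree_sequence :: "'a set \<Rightarrow> 'a set set \<Rightarrow> nat list" where
  "degree_sequence V E = rev (sorted_list_of_multiset (image_mset (degree E) (mset_set V)))"

text \<open>In \<open>beta_of\<close> the range of \<open>j\<close> loses nothing: for \<open>j > length d\<close> the difference is not
  positive.\<close>

definition alpha_of :: "nat list \<Rightarrow> nat list" where
  "alpha_of d = map (\<lambda>i. d ! (i - 1) - i + 1)
                  (filter (\<lambda>i. d ! (i - 1) \<ge> i) [1..<length d + 1])"

definition conj_part :: "nat list \<Rightarrow> nat \<Rightarrow> nat" where
  "conj_part d j = card {i. i < length d \<and> d ! i \<ge> j}"

definition beta_of :: "nat list \<Rightarrow> nat list" where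
  "beta_of d = map (\<lambda>j. conj_part d j - j) (filter (\<lambda>j. conj_part d j > j) [1..<length d + 1])"

definition NG_graph :: "'a set \<Rightarrow> 'a set set \<Rightarrow> bool" where
  "NG_graph V E \<longleftrightarrow> simple_graph V E \<and> no_isolated V E \<and>
     chromatic_number V E + chromatic_number V (complement_edges V E) = card V + 1"

text \<open>\<open>deg v = chi - 1\<close> is written additively to avoid truncated subtraction.\<close>

definition A_set :: "'a set \<Rightarrow> 'a set set \<Rightarrow> 'a set" where
  "A_set V E = {v \<in> V. degree E v + 1 = chromatic_number V E}"

definition NG1_graph :: "'a set \<Rightarrow> 'a set set \<Rightarrow> bool" where
  "NG1_graph V E \<longleftrightarrow> NG_graph V E \<and> clique (A_set V E) E"

definition NG2_graph :: "'a set \<Rightarrow> 'a set set \<Rightarrow> bool" where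
  "NG2_graph V E \<longleftrightarrow> NG_graph V E \<and> indep (A_set V E) E"

text \<open>Every finite graph is isomorphic to one whose vertices are natural numbers, so nothing is lost
  by the choice of vertex type below.\<close>

definition NG1_block :: "block \<Rightarrow> bool" where
  "NG1_block X \<longleftrightarrow> (\<exists>(V :: nat set) E. NG1_graph V E \<and>
     X = (alpha_of (degree_sequence V E), beta_of (degree_sequence V E)))"

definition NG2_block :: "block \<Rightarrow> bool" where
  "NG2_block X \<longleftrightarrow> (\<exists>(V :: nat set) E. NG2_graph V E \<and>
     X = (alpha_of (degree_sequence V E), beta_of (degree_sequence V E)))"

definition NG1 :: "nat \<Rightarrow> nat \<Rightarrow> block set" where
  "NG1 n k = {X \<in> A_blocks n k. NG1_block X}"

definition NG2 :: "nat \<Rightarrow> nat \<Rightarrow> block set" where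
  "NG2 n k = {X \<in> A_blocks n k. NG2_block X}"

text \<open>The poset is given by its carrier \<open>P\<close> and its order relation \<open>le\<close>.\<close>

definition antichain_in :: "'a set \<Rightarrow> ('a \<Rightarrow> 'a \<Rightarrow> bool) \<Rightarrow> 'a set \<Rightarrow> bool" where
  "antichain_in P le A \<longleftrightarrow> A \<subseteq> P \<and> (\<forall>a\<in>A. \<forall>b\<in>A. le a b \<longrightarrow> a = b)"

definition amphora :: "'a set \<Rightarrow> ('a \<Rightarrow> 'a \<Rightarrow> bool) \<Rightarrow> 'a set \<Rightarrow> bool" where
  "amphora P le Q \<longleftrightarrow>
     (\<exists>A x. antichain_in P le A \<and> x \<in> P \<and> (\<forall>a\<in>A. le x a) \<and>
            Q = {p \<in> P. le x p \<and> (\<exists>a\<in>A. le p a)})"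

end

theory Submission
  imports Defs
begin

text \<open>The intersection consists of the blocks \<open>[a|b]\<close> in which \<open>a\<close> and \<open>b\<close> have \<open>k\<close> parts, the
  last part of \<open>a\<close> is at least \<open>2\<close>, and the last part of \<open>b\<close> is \<open>1\<close>
  (\<open>NG1_Int_NG2_eq_last_parts\<close>).  After this description no graphs are involved any more.

  In one direction, let a graph have a degree sequence whose block lies in \<open>A(n, k)\<close>.  That
  \<open>alpha\<close> and \<open>beta\<close> have equal sums makes the graph split, with the \<open>k\<close> vertices of largest degree
  as clique and all other vertices as stable set, and its chromatic number is \<open>k + 1\<close>
  (\<open>block_of_equal_lengths_split\<close>).  So \<open>A_G\<close> is the set of vertices of degree \<open>k\<close>.  If it is a
  clique, then exactly \<open>k + 1\<close> vertices have degree at least \<open>k\<close>, and the last part of \<open>beta\<close>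
  counts those beyond the first \<open>k\<close>.  If it is stable, then the clique has only vertices of degree
  greater than \<open>k\<close>, which bounds the last part of \<open>alpha\<close> from below.  Conversely, a block with such
  last parts is realized by one graph with a single vertex of degree \<open>k\<close>, which is therefore NG-1
  and NG-2 at once (\<open>NG_blocks_of_last_parts\<close>).  The edges between its clique and its stable set
  come from the Gale--Ryser theorem, for which \<open>b\<close> majorizing \<open>a\<close> is exactly the dominance condition.

  On the side of the order, a larger partition has no more parts, and among partitions with the
  same number of parts it has a smaller or equal last part.  A chain from \<open>a\<close> up to \<open>b\<close>
  therefore stays among the partitions with \<open>k\<close> parts, and the last part drops from at least \<open>2\<close> to
  \<open>1\<close> at some cover relation in it (\<open>cover_leaving_property\<close>); this gives the block above
  \<open>[a|b]\<close>.  The block \<open>[tau|tau']\<close> lies below because \<open>tau\<close> is the least and \<open>tau'\<close> the greatest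
  partition with \<open>k\<close> distinct parts.  Conversely, a block between \<open>[tau|tau']\<close> and a block whose
  partitions have \<open>k\<close> parts and the given last parts has, by the same monotonicity, \<open>k\<close> parts and
  such last parts itself.\<close>

section \<open>The majorization order\<close>

lemma sum_list_take_mono:
  fixes g :: "nat list"
  assumes "m \<le> m'"
  shows "sum_list (take m g) \<le> sum_list (take m' g)"
proof -
  have "take m' g = take m g @ take (m' - m) (drop m g)"
    using assms by (metis le_add_diff_inverse take_add)
  then show ?thesis by simp
qed

lemma sum_list_take_le:
  fixes g :: "nat list"
  shows "sum_list (take m g) \<le> sum_list g"
  by (metis append_take_drop_id le_add1 sum_list_append)

lemma majorizes_iff:
  assumes "d \<in> Dis n" "g \<in> Dis n"
  shows "majorizes d g \<longleftrightarrow> (\<forall>m. sum_list (take m g) \<le> sum_list (take m d))"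
proof
  assume maj: "majorizes d g"
  have sums: "sum_list d = n" "sum_list g = n" using assms by (auto simp: Dis_def)
  show "\<forall>m. sum_list (take m g) \<le> sum_list (take m d)"
  proof
    fix m
    consider "length d \<le> m" | "m < length d" "m \<le> length g" | "m < length d" "length g < m"
      by linarith
    then show "sum_list (take m g) \<le> sum_list (take m d)"
    proof cases
      case 1
      then show ?thesis using sums sum_list_take_le[of m g] by simp
    next
      case 2
      then show ?thesis using maj by (simp add: majorizes_def)
    next
      case 3
      then have "sum_list (take (length g) g) \<le> sum_list (take (length g) d)"
        using maj unfolding majorizes_def by (metis less_or_eq_imp_le less_trans min.bounded_iff)
      then show ?thesis
        using 3 sums sum_list_take_mono[of "length g" m d] by simp
    qed
  qed
qed (auto simp: majorizes_def)

lemma majorizes_refl: "majorizes d d"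
  by (simp add: majorizes_def)

lemma majorizes_trans:
  assumes "a \<in> Dis n" "b \<in> Dis n" "c \<in> Dis n" "majorizes a b" "majorizes b c"
  shows "majorizes a c"
  using assms by (meson le_trans majorizes_iff)

text \<open>The parts are positive, so a partition reaches the total \<open>n\<close> only with its last part; a
  larger partition reaches it no later.\<close>

lemma majorizes_length_le:
  assumes "d \<in> Dis n" "g \<in> Dis n" "majorizes d g"
  shows "length d \<le> length g"
proof -
  let ?m = "length g"
  have "n \<le> sum_list (take ?m d)"
    using assms majorizes_iff[OF assms(1,2)] by (auto simp: Dis_def dest: spec[of _ ?m])
  moreover have "sum_list (take ?m d) + sum_list (drop ?m d) = n"
    using assms(1) by (metis (mono_tags, lifting) Dis_def append_take_drop_id mem_Collect_eq sum_list_append)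
  ultimately have "sum_list (drop ?m d) = 0" by linarith
  moreover have "\<forall>x\<in>set (drop ?m d). 0 < x"
    using assms(1) by (auto simp: Dis_def dest: in_set_dropD)
  ultimately show ?thesis
    by (metis drop_eq_Nil list.set_intros(1) neq_Nil_conv not_gr_zero sum_list_eq_0_iff)
qed

lemma majorizes_antisym:
  assumes "a \<in> Dis n" "b \<in> Dis n" "majorizes a b" "majorizes b a"
  shows "a = b"
proof (rule nth_equalityI)
  show len: "length a = length b"
    using assms by (meson antisym majorizes_length_le)
  fix i assume i: "i < length a"
  have eq: "sum_list (take m a) = sum_list (take m b)" for m
    using assms by (meson antisym majorizes_iff)
  show "a ! i = b ! i"
    using eq[of "Suc i"] eq[of i] i len by (simp add: take_Suc_conv_app_nth)
qed

lemma majorizes_last_le: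
  assumes "d \<in> Dis n" "g \<in> Dis n" "majorizes d g" "length d = length g" "d \<noteq> []"
  shows "last d \<le> last g"
proof -
  have *: "sum_list (butlast x) + last x = sum_list x" if "x \<noteq> []" for x :: "nat list"
    using that by (metis append_butlast_last_id sum_list.Cons sum_list.Nil sum_list_append add.right_neutral)
  have "sum_list (butlast g) \<le> sum_list (butlast d)"
    using assms majorizes_iff[OF assms(1,2)] by (simp add: butlast_conv_take)
  moreover have "g \<noteq> []" "sum_list g = sum_list d"
    using assms by (auto simp: Dis_def)
  ultimately show ?thesis using *[of g] *[of d] assms(5) by linarith
qed

lemma finite_Dis: "finite (Dis n)"
proof (rule finite_subset)
  have "length g \<le> sum_list g" if "\<forall>x\<in>set g. 0 < x" for g :: "nat list"
    using that by (induction g) auto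
  then show "Dis n \<subseteq> {xs. set xs \<subseteq> {..n} \<and> length xs \<le> n}"
    by (auto simp: Dis_def member_le_sum_list)
qed (simp add: finite_lists_length_le)

text \<open>A maximal chain from \<open>a\<close> up to \<open>b\<close> leaves \<open>P\<close> at some cover relation.  It is found as a pair
  \<open>(x, y)\<close> with \<open>P x\<close> and \<open>\<not> P y\<close> that has the smallest interval: a partition strictly between
  could replace \<open>x\<close> or \<open>y\<close>, according to whether it satisfies \<open>P\<close>.\<close>

lemma cover_leaving_property:
  assumes "a \<in> Dis n" "b \<in> Dis n" "majorizes b a" "P a" "\<not> P b"
  shows "\<exists>a' b'. majorizes a' a \<and> majorizes b b' \<and> P a' \<and> \<not> P b' \<and> covers_Dis n b' a'"
proof -
  define I where "I x y = {c \<in> Dis n. majorizes c x \<and> majorizes y c}" for x y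
  define Q where "Q = (\<lambda>(x, y). x \<in> Dis n \<and> y \<in> Dis n \<and> majorizes y x \<and> majorizes x a \<and>
    majorizes b y \<and> P x \<and> \<not> P y)"
  have "Q (a, b)" using assms by (simp add: Q_def majorizes_refl)
  then obtain p where p: "Q p" "\<And>p'. Q p' \<Longrightarrow> card (I (fst p) (snd p)) \<le> card (I (fst p') (snd p'))"
    using ex_has_least_nat[of Q _ "\<lambda>p. card (I (fst p) (snd p))"] by blast
  obtain x y where xy: "p = (x, y)" by fastforce
  have Q: "x \<in> Dis n" "y \<in> Dis n" "majorizes y x" "majorizes x a" "majorizes b y" "P x" "\<not> P y"
    using p(1) by (auto simp: Q_def xy)
  have fin: "finite (I u v)" for u v by (simp add: I_def finite_Dis)
  have "c = x \<or> c = y" if c: "c \<in> Dis n" "majorizes y c" "majorizes c x" for c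
  proof (rule ccontr)
    assume ne: "\<not> (c = x \<or> c = y)"
    show False
    proof (cases "P c")
      case True
      have "Q (c, y)" using c Q True assms majorizes_trans[of c n x a] by (simp add: Q_def)
      then have "card (I x y) \<le> card (I c y)" using p(2) xy by force
      moreover have "I c y \<subset> I x y"
      proof
        show "I c y \<subseteq> I x y" using c Q majorizes_trans unfolding I_def by blast
        show "I c y \<noteq> I x y"
          using c Q ne majorizes_antisym[of c n x] majorizes_refl[of x] unfolding I_def by blast
      qed
      ultimately show False using psubset_card_mono[OF fin] by (meson not_le)
    next
      case False
      have "Q (x, c)" using c Q False assms majorizes_trans[of b n y c] by (simp add: Q_def)
      then have "card (I x y) \<le> card (I x c)" using p(2) xy by force
      moreover have "I x c \<subset> I x y"
      proof
        show "I x c \<subseteq> I x y" using c Q majorizes_trans unfolding I_def by blast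
        show "I x c \<noteq> I x y"
          using c Q ne majorizes_antisym[of c n y] majorizes_refl[of y] unfolding I_def by blast
      qed
      ultimately show False using psubset_card_mono[OF fin] by (meson not_le)
    qed
  qed
  then have "covers_Dis n y x" using Q by (auto simp: covers_Dis_def)
  then show ?thesis using Q by blast
qed

section \<open>The extreme partitions with a given number of parts\<close>

lemma sum_staircase: "(\<Sum>i<k. k - i) = (k + 1) choose 2"
proof (induction k)
  case 0
  then show ?case by simp
next
  case (Suc k)
  have "(\<Sum>i<Suc k. Suc k - i) = Suc k + (\<Sum>i<k. k - i)"
    by (subst sum.lessThan_Suc_shift) simp
  then show ?case using Suc by (simp add: numeral_2_eq_2)
qed

lemma Dis_nth_gap:
  assumes "g \<in> Dis n" "i \<le> j" "j < length g"
  shows "g ! j + j \<le> g ! i + i"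
  using assms(2,3)
proof (induction j rule: dec_induct)
  case (step j)
  have "g ! Suc j < g ! j"
    using assms(1) step by (auto simp: Dis_def sorted_wrt_iff_nth_less)
  then show ?case using step by simp
qed simp

lemma Dis_nth_ge:
  assumes "g \<in> Dis n" "i < length g"
  shows "length g - i \<le> g ! i"
proof -
  have "g ! (length g - 1) + (length g - 1) \<le> g ! i + i"
    using assms by (intro Dis_nth_gap) auto
  moreover have "0 < g ! (length g - 1)"
    using assms by (auto simp: Dis_def)
  ultimately show ?thesis using assms(2) by linarith
qed

lemma sum_list_take_eq_sum:
  fixes g :: "nat list"
  assumes "m \<le> length g"
  shows "sum_list (take m g) = (\<Sum>i<m. g ! i)"
  using assms by (simp add: sum_list_sum_nth min_def atLeast0LessThan)

lemma majorizes_iff_sum: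
  assumes "length d = k" "length g = k"
  shows "majorizes d g \<longleftrightarrow> (\<forall>m\<le>k. (\<Sum>i<m. g ! i) \<le> (\<Sum>i<m. d ! i))"
  using assms by (auto simp: majorizes_def sum_list_take_eq_sum)

lemma Dis_len_iff:
  "g \<in> Dis_len k n \<longleftrightarrow> length g = k \<and> (\<forall>i<k. 0 < g ! i) \<and> (\<forall>i j. i < j \<longrightarrow> j < k \<longrightarrow> g ! j < g ! i) \<and>
     (\<Sum>i<k. g ! i) = n"
  using sum_list_take_eq_sum[of "length g" g]
  by (auto simp: Dis_len_def Dis_def sorted_wrt_iff_nth_less all_set_conv_all_nth)

lemma tau'_nth:
  assumes "0 < k"
  shows "length (tau' k n) = k" "tau' k n ! 0 = n - (k choose 2)"
    and "\<And>i. 0 < i \<Longrightarrow> i < k \<Longrightarrow> tau' k n ! i = k - i"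
  using assms by (auto simp: tau'_def nth_Cons' rev_nth)

lemma tau'_in_Dis_len:
  assumes "0 < k" "(k + 1) choose 2 \<le> n"
  shows "tau' k n \<in> Dis_len k n"
proof -
  obtain l where l: "k = Suc l" using assms(1) gr0_conv_Suc by blast
  have k2: "(k + 1) choose 2 = k + (k choose 2)"
    by (simp add: numeral_2_eq_2)
  have "(\<Sum>i<k. tau' k n ! i) = n - (k choose 2) + (\<Sum>i<l. tau' k n ! Suc i)"
    unfolding l by (subst sum.lessThan_Suc_shift) (simp add: tau'_nth)
  also have "(\<Sum>i<l. tau' k n ! Suc i) = (\<Sum>i<l. l - i)"
    by (rule sum.cong) (auto simp: tau'_nth l)
  also have "\<dots> = k choose 2" by (simp add: sum_staircase l)
  finally have sum: "(\<Sum>i<k. tau' k n ! i) = n" using assms(2) k2 by simp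
  have "k \<le> tau' k n ! 0" using assms k2 by (simp add: tau'_nth)
  then have ge: "k - i \<le> tau' k n ! i" if "i < k" for i
    using that assms(1) by (cases "i = 0") (auto simp: tau'_nth)
  have "tau' k n ! j < tau' k n ! i" if "i < j" "j < k" for i j
    using that assms(1) ge[of i] by (simp add: tau'_nth)
  moreover have "0 < tau' k n ! i" if "i < k" for i
    using that ge[of i] by simp
  ultimately show ?thesis
    using sum tau'_nth(1)[OF assms(1)] by (simp add: Dis_len_iff)
qed

text \<open>The parts of a partition after the first are at least those of the staircase \<open>k-1, \<dots>, 1\<close>,
  which are the corresponding parts of \<open>tau'\<close>.\<close>

lemma tau'_majorizes:
  assumes "0 < k" "(k + 1) choose 2 \<le> n" "g \<in> Dis_len k n"
  shows "majorizes (tau' k n) g"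
proof -
  have len: "length g = k" and g: "g \<in> Dis n" using assms(3) by (auto simp: Dis_len_def)
  have "(\<Sum>i<m. g ! i) \<le> (\<Sum>i<m. tau' k n ! i)" if "m \<le> k" for m
  proof (cases "m = 0")
    case False
    have split: "(\<Sum>i<k. h i) = (\<Sum>i<m. h i) + (\<Sum>i\<in>{m..<k}. h i)" for h :: "nat \<Rightarrow> nat"
      using sum.atLeastLessThan_concat[of 0 m k h] that by (simp add: lessThan_atLeast0)
    have "(\<Sum>i\<in>{m..<k}. tau' k n ! i) \<le> (\<Sum>i\<in>{m..<k}. g ! i)"
    proof (rule sum_mono)
      fix i assume "i \<in> {m..<k}"
      then show "tau' k n ! i \<le> g ! i"
        using False Dis_nth_ge[OF g, of i] len assms(1) by (simp add: tau'_nth)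
    qed
    moreover have "(\<Sum>i<k. g ! i) = (\<Sum>i<k. tau' k n ! i)"
      using assms(3) tau'_in_Dis_len[OF assms(1,2)] by (simp add: Dis_len_iff)
    ultimately show ?thesis using split[of "\<lambda>i. g ! i"] split[of "\<lambda>i. tau' k n ! i"] by linarith
  qed simp
  then show ?thesis using len tau'_nth(1)[OF assms(1)] by (simp add: majorizes_iff_sum)
qed

text \<open>Among antitone sequences of \<open>k\<close> terms with sum \<open>q k + r\<close>, the balanced one has the least
  partial sums.  Suppose that the first \<open>m\<close> terms of another one had a smaller sum.  If a later term
  exceeds \<open>q\<close> then, by monotonicity, so do the first \<open>m\<close> terms, whose sum is then too large.
  Otherwise the later terms are at most \<open>q\<close> each, and the total is too small.\<close>

lemma balanced_sum_least:
  fixes e :: "nat \<Rightarrow> nat"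
  assumes anti: "\<And>i j. i \<le> j \<Longrightarrow> j < k \<Longrightarrow> e j \<le> e i"
    and sum: "(\<Sum>i<k. e i) = q * k + r" and "r < k" "m \<le> k"
  shows "(\<Sum>i<m. if i < r then q + 1 else q) \<le> (\<Sum>i<m. e i)"
proof (rule ccontr)
  assume "\<not> ?thesis"
  then have less: "(\<Sum>i<m. e i) < (\<Sum>i<m. if i < r then q + 1 else q)" by simp
  have balanced: "(\<Sum>i<m. if i < r then q + 1 else q) = q * m + min m r" for m
    by (induction m) auto
  have split: "(\<Sum>i<k. e i) = (\<Sum>i<m. e i) + (\<Sum>i\<in>{m..<k}. e i)"
    using sum.atLeastLessThan_concat[of 0 m k e] \<open>m \<le> k\<close> by (simp add: lessThan_atLeast0)
  show False
  proof (cases "\<exists>i\<in>{m..<k}. q < e i")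
    case True
    then obtain i where i: "m \<le> i" "i < k" "q < e i" by auto
    have "(\<Sum>j<m. q + 1) \<le> (\<Sum>j<m. e j)"
    proof (rule sum_mono)
      fix j assume "j \<in> {..<m}"
      then show "q + 1 \<le> e j" using anti[of j i] i by simp
    qed
    then show False using less balanced[of m] by (simp add: algebra_simps)
  next
    case False
    then have "(\<Sum>i\<in>{m..<k}. e i) \<le> (\<Sum>i\<in>{m..<k}. q)"
      by (intro sum_mono) (meson not_le)
    moreover have "q * m + (k - m) * q = q * k"
      using \<open>m \<le> k\<close> by (metis add_mult_distrib2 le_add_diff_inverse mult.commute)
    ultimately show False using less balanced[of m] split sum by simp
  qed
qed

lemma tau_nth:
  assumes "i < k"
  shows "tau k n ! i = (if i < (n - ((k + 1) choose 2)) mod k then (n - ((k + 1) choose 2)) div k + 1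
    else (n - ((k + 1) choose 2)) div k) + (k - i)"
  using assms by (auto simp: tau_def Let_def Suc_le_eq simp del: upt_Suc)

lemma length_tau: "length (tau k n) = k"
  by (simp add: tau_def Let_def del: upt_Suc)

lemma tau_in_Dis_len:
  assumes "0 < k" "(k + 1) choose 2 \<le> n"
  shows "tau k n \<in> Dis_len k n"
proof -
  let ?N = "n - ((k + 1) choose 2)"
  let ?s = "\<lambda>i. if i < ?N mod k then ?N div k + 1 else ?N div k"
  have "(\<Sum>i<m. ?s i) = ?N div k * m + min m (?N mod k)" for m
    by (induction m) auto
  moreover have "min k (?N mod k) = ?N mod k"
    using assms(1) by (simp add: less_imp_le)
  ultimately have "(\<Sum>i<k. ?s i) = ?N" by (metis div_mult_mod_eq)
  moreover have "(\<Sum>i<k. tau k n ! i) = (\<Sum>i<k. ?s i) + (\<Sum>i<k. k - i)"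
    unfolding sum.distrib[symmetric] by (rule sum.cong) (auto simp: tau_nth)
  ultimately have "(\<Sum>i<k. tau k n ! i) = n" using assms(2) by (simp add: sum_staircase)
  moreover have "tau k n ! j < tau k n ! i" if "i < j" "j < k" for i j
    using that by (auto simp: tau_nth)
  ultimately show ?thesis by (auto simp: Dis_len_iff length_tau tau_nth)
qed

text \<open>Subtracting the staircase \<open>k, \<dots>, 1\<close> turns partitions into distinct parts into antitone
  sequences, and turns \<open>tau\<close> into the balanced one.\<close>

lemma majorizes_tau:
  assumes "0 < k" "(k + 1) choose 2 \<le> n" "g \<in> Dis_len k n"
  shows "majorizes g (tau k n)"
proof -
  let ?N = "n - ((k + 1) choose 2)"
  let ?e = "\<lambda>i. g ! i - (k - i)"
  have len: "length g = k" and g: "g \<in> Dis n" using assms(3) by (auto simp: Dis_len_def)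
  have ge: "g ! i = ?e i + (k - i)" if "i < k" for i
    using Dis_nth_ge[OF g, of i] that len by simp
  have split: "(\<Sum>i<m. g ! i) = (\<Sum>i<m. ?e i) + (\<Sum>i<m. k - i)" if "m \<le> k" for m
    unfolding sum.distrib[symmetric] by (rule sum.cong) (use ge that in auto)
  have "(\<Sum>i<m. tau k n ! i) \<le> (\<Sum>i<m. g ! i)" if "m \<le> k" for m
  proof -
    have "(\<Sum>i<m. if i < ?N mod k then ?N div k + 1 else ?N div k) \<le> (\<Sum>i<m. ?e i)"
    proof (rule balanced_sum_least)
      show "?e j \<le> ?e i" if "i \<le> j" "j < k" for i j
        using Dis_nth_gap[OF g, of i j] that len by simp
      have "(\<Sum>i<k. g ! i) = n" using assms(3) by (simp add: Dis_len_iff)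
      then show "(\<Sum>i<k. ?e i) = ?N div k * k + ?N mod k"
        using split[of k] sum_staircase[of k] by simp
    qed (use assms(1) that in auto)
    moreover have "(\<Sum>i<m. tau k n ! i) =
        (\<Sum>i<m. if i < ?N mod k then ?N div k + 1 else ?N div k) + (\<Sum>i<m. k - i)"
      unfolding sum.distrib[symmetric] by (rule sum.cong) (use that in \<open>auto simp: tau_nth\<close>)
    ultimately show ?thesis using split[OF that] by simp
  qed
  then show ?thesis using len length_tau by (simp add: majorizes_iff_sum)
qed

section \<open>Degrees and colourings\<close>

lemma degree_eq_card_neighbours:
  assumes "simple_graph V E" "v \<in> V"
  shows "degree E v = card {u \<in> V. {u, v} \<in> E}"
proof -
  have E: "E \<subseteq> [V]\<^bsup>2\<^esup>" using assms by (simp add: simple_graph_def)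
  have "bij_betw (\<lambda>u. {u, v}) {u \<in> V. {u, v} \<in> E} {e \<in> E. v \<in> e}"
  proof (rule bij_betw_imageI)
    show "inj_on (\<lambda>u. {u, v}) {u \<in> V. {u, v} \<in> E}"
      by (auto simp: inj_on_def doubleton_eq_iff)
    show "(\<lambda>u. {u, v}) ` {u \<in> V. {u, v} \<in> E} = {e \<in> E. v \<in> e}"
    proof
      show "{e \<in> E. v \<in> e} \<subseteq> (\<lambda>u. {u, v}) ` {u \<in> V. {u, v} \<in> E}"
      proof
        fix e assume "e \<in> {e \<in> E. v \<in> e}"
        then have e: "e \<in> E" "v \<in> e" by auto
        then obtain x y where "e = {x, y}" "x \<in> V" "y \<in> V"
          using E by (meson nsets2_E subsetD)
        then show "e \<in> (\<lambda>u. {u, v}) ` {u \<in> V. {u, v} \<in> E}"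
          using e by (auto simp: insert_commute image_iff)
      qed
    qed auto
  qed
  then show ?thesis by (simp add: degree_def bij_betw_same_card)
qed

lemma not_edge_self:
  assumes "simple_graph V E"
  shows "{v} \<notin> E"
proof
  assume "{v} \<in> E"
  then have "{v} \<in> [V]\<^bsup>2\<^esup>" using assms by (auto simp: simple_graph_def)
  then show False by (auto simp: nsets_def)
qed

lemma degree_sequence_eqI:
  assumes "distinct vs" "set vs = V" "sorted_wrt (\<ge>) (map (degree E) vs)"
  shows "degree_sequence V E = map (degree E) vs"
proof -
  have "mset_set V = mset vs" using assms(1,2) mset_set_set by blast
  moreover have "sorted (rev (map (degree E) vs))"
    using assms(3) by (simp add: sorted_wrt_rev)
  then have "sort (map (degree E) vs) = rev (map (degree E) vs)"
    by (metis mset_rev properties_for_sort)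
  ultimately show ?thesis
    by (simp add: degree_sequence_def flip: mset_map)
qed

lemma degree_sequence_enumeration:
  fixes V :: "nat set"
  assumes "finite V"
  obtains vs where "distinct vs" "set vs = V" "sorted_wrt (\<ge>) (map (degree E) vs)"
    "degree_sequence V E = map (degree E) vs"
proof -
  define vs where "vs = rev (sort_key (degree E) (sorted_list_of_set V))"
  have "sorted_wrt (\<ge>) (map (degree E) vs)"
    by (simp add: vs_def rev_map[symmetric] sorted_wrt_rev)
  moreover have "distinct vs" "set vs = V" using assms by (auto simp: vs_def)
  ultimately show ?thesis using that degree_sequence_eqI by blast
qed

lemma chromatic_number_eqI:
  assumes "finite V" "K \<subseteq> V" "clique K E" "colorable V E (card K)"
  shows "chromatic_number V E = card K"
  unfolding chromatic_number_def
proof (rule Least_equality)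
  fix c assume "colorable V E c"
  then obtain f :: "'a \<Rightarrow> nat" where f: "f ` V \<subseteq> {..<c}"
    "\<And>u v. u \<in> V \<Longrightarrow> v \<in> V \<Longrightarrow> {u, v} \<in> E \<Longrightarrow> f u \<noteq> f v"
    by (auto simp: colorable_def)
  have "inj_on f K"
    using f(2) assms(2,3) unfolding clique_def by (intro inj_onI) blast
  moreover have "f ` K \<subseteq> {..<c}" using f(1) assms(2) by auto
  ultimately show "card K \<le> c" by (metis card_inj_on_le card_lessThan finite_lessThan)
qed (rule assms)

text \<open>Colour \<open>K\<close> injectively and give every other vertex the colour of \<open>x\<close>.\<close>

lemma colorable_split:
  assumes "finite V" "K \<subseteq> V" "x \<in> K" "indep (V - K \<union> {x}) E" "\<And>v. {v} \<notin> E"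
  shows "colorable V E (card K)"
proof -
  have "finite K" using assms finite_subset by blast
  then obtain h where h: "bij_betw h K {..<card K}"
    using finite_imp_nat_seg_image_inj_on ex_bij_betw_finite_nat
    by (metis atLeast0LessThan)
  let ?f = "\<lambda>v. if v \<in> K then h v else h x"
  have "?f ` V \<subseteq> {..<card K}" using h assms(2,3) by (auto simp: bij_betw_def)
  moreover have "?f u \<noteq> ?f v" if "u \<in> V" "v \<in> V" "{u, v} \<in> E" for u v
  proof
    assume eq: "?f u = ?f v"
    have ne: "u \<noteq> v" using that assms(5) by auto
    then have "u \<in> V - K \<union> {x} \<and> v \<in> V - K \<union> {x}"
      using eq that h assms(3) by (auto simp: bij_betw_def inj_on_def split: if_splits)
    then show False using assms(4) ne that(3) by (auto simp: indep_def)
  qed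
  ultimately show ?thesis unfolding colorable_def by blast
qed

lemma chromatic_number_split:
  assumes "simple_graph V E" "T \<subseteq> V" "clique T E" "indep (V - T) E"
    and "v \<in> V - T" "\<And>t. t \<in> T \<Longrightarrow> {t, v} \<in> E"
  shows "chromatic_number V E = card T + 1"
proof -
  have fin: "finite V" "finite T" using assms finite_subset by (auto simp: simple_graph_def)
  have "clique (insert v T) E"
    using assms(3,6) by (auto simp: clique_def insert_commute)
  moreover have "V - insert v T \<union> {v} = V - T" using assms(5) by auto
  then have "colorable V E (card (insert v T))"
    using assms fin by (intro colorable_split[of _ _ v] not_edge_self[OF assms(1)]) auto
  ultimately have "chromatic_number V E = card (insert v T)"
    using assms fin by (intro chromatic_number_eqI) auto
  then show ?thesis using assms(5) fin by simp
qed

text \<open>In the complement graph \<open>V - T\<close> is a clique, and \<open>T\<close> together with \<open>v\<close> is stable because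
  \<open>v\<close> is adjacent to all of \<open>T\<close> in the graph itself.  So \<open>T\<close> can share the colour of \<open>v\<close>.\<close>

lemma chromatic_number_complement_split:
  assumes "simple_graph V E" "T \<subseteq> V" "clique T E" "indep (V - T) E"
    and "v \<in> V - T" "\<And>t. t \<in> T \<Longrightarrow> {t, v} \<in> E"
  shows "chromatic_number V (complement_edges V E) = card V - card T"
proof -
  let ?F = "complement_edges V E"
  have fin: "finite V" "finite T" using assms finite_subset by (auto simp: simple_graph_def)
  have "clique (V - T) ?F"
    using assms(4) by (auto simp: clique_def indep_def complement_edges_def)
  moreover have "V - (V - T) \<union> {v} = insert v T" using assms(2) by auto
  moreover have "indep (insert v T) ?F"
    using assms(3,6) by (auto simp: clique_def indep_def complement_edges_def insert_commute)
  ultimately have "chromatic_number V ?F = card (V - T)"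
    using assms(5) fin
    by (intro chromatic_number_eqI colorable_split[of _ _ v]) (auto simp: complement_edges_def nsets_def)
  then show ?thesis using assms(2) fin by (simp add: card_Diff_subset)
qed

text \<open>Count edges by their ends: the vertices of \<open>T\<close> have at most \<open>k (k - 1)\<close> ends of edges inside
  \<open>T\<close>, and the edges leaving \<open>T\<close> are at most as many as the ends in \<open>V - T\<close>.  Equality forces
  \<open>T\<close> to be a clique and \<open>V - T\<close> to be stable.\<close>

lemma split_of_degree_sums:
  assumes G: "simple_graph V E" and T: "T \<subseteq> V" "card T = k"
    and sums: "(\<Sum>v\<in>T. degree E v) + k = (\<Sum>v\<in>V - T. degree E v) + k * k"
  shows "clique T E" "indep (V - T) E"
proof -
  have fin: "finite V" "finite T" using G T finite_subset by (auto simp: simple_graph_def)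
  define a where "a v = card {u \<in> T. {u, v} \<in> E}" for v
  define b where "b v = card {u \<in> V - T. {u, v} \<in> E}" for v
  have deg: "degree E v = a v + b v" if "v \<in> V" for v
  proof -
    have "{u \<in> V. {u, v} \<in> E} = {u \<in> T. {u, v} \<in> E} \<union> {u \<in> V - T. {u, v} \<in> E}"
      using T by auto
    then show ?thesis
      using fin unfolding degree_eq_card_neighbours[OF G that] a_def b_def
      by (subst card_Un_disjoint[symmetric]) auto
  qed
  have cross: "(\<Sum>v\<in>T. b v) = (\<Sum>v\<in>V - T. a v)"
    unfolding a_def b_def
    by (rule sum_multicount_gen) (use fin in \<open>auto simp: insert_commute\<close>)
  have a_le: "a v + 1 \<le> k" if "v \<in> T" for v
  proof -
    have "{u \<in> T. {u, v} \<in> E} \<subseteq> T - {v}" using not_edge_self[OF G] by auto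
    then have "a v \<le> card (T - {v})" unfolding a_def using fin by (intro card_mono) auto
    then show ?thesis using that T fin by (metis Suc_eq_plus1 Suc_le_mono card_Suc_Diff1)
  qed
  have "(\<Sum>v\<in>T. degree E v) = (\<Sum>v\<in>T. a v) + (\<Sum>v\<in>T. b v)"
    unfolding sum.distrib[symmetric] by (rule sum.cong) (use deg T in auto)
  moreover have "(\<Sum>v\<in>V - T. degree E v) = (\<Sum>v\<in>V - T. a v) + (\<Sum>v\<in>V - T. b v)"
    unfolding sum.distrib[symmetric] by (rule sum.cong) (use deg in auto)
  moreover have "(\<Sum>v\<in>T. a v + 1) = (\<Sum>v\<in>T. a v) + k"
    using T by (simp add: sum.distrib del: add_Suc_right)
  ultimately have key: "(\<Sum>v\<in>T. a v + 1) = k * k + (\<Sum>v\<in>V - T. b v)"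
    using sums cross by linarith
  have "(\<Sum>v\<in>T. a v + 1) \<le> (\<Sum>v\<in>T. k)" by (rule sum_mono) (use a_le in auto)
  then have b0: "(\<Sum>v\<in>V - T. b v) = 0" and eq: "(\<Sum>v\<in>T. a v + 1) = (\<Sum>v\<in>T. k)"
    using key T by simp_all
  show "indep (V - T) E"
  proof -
    have "b v = 0" if "v \<in> V - T" for v using b0 that fin by simp
    then show ?thesis using fin unfolding b_def indep_def by (auto simp: card_eq_0_iff)
  qed
  show "clique T E"
    unfolding clique_def
  proof (intro ballI impI)
    fix v w assume vw: "v \<in> T" "w \<in> T" "v \<noteq> w"
    have "a w + 1 = k"
      using sum_mono_inv[OF eq a_le vw(2) fin(2)] .
    moreover have "card (T - {w}) + 1 = k" using vw T fin by (metis Suc_eq_plus1 card_Suc_Diff1)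
    moreover have "{u \<in> T. {u, w} \<in> E} \<subseteq> T - {w}" using not_edge_self[OF G] by auto
    ultimately have "{u \<in> T. {u, w} \<in> E} = T - {w}"
      unfolding a_def using fin by (intro card_subset_eq) auto
    then show "{v, w} \<in> E" using vw by blast
  qed
qed

section \<open>Degree sequences with blocks of equal lengths\<close>

lemma downset_eq_lessThan_card:
  fixes S :: "nat set"
  assumes "finite S" "\<And>i j. i \<in> S \<Longrightarrow> j \<le> i \<Longrightarrow> j \<in> S"
  shows "S = {..<card S}"
proof -
  define m where "m = (LEAST i. i \<notin> S)"
  have "\<exists>i. i \<notin> S" using assms(1) ex_new_if_finite infinite_UNIV_nat by blast
  then have m: "m \<notin> S" unfolding m_def by (rule LeastI_ex)
  moreover have "i \<in> S" if "i < m" for i using that not_less_Least m_def by blast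
  ultimately have "S = {..<m}" using assms(2) by (auto simp: not_less[symmetric])
  then show ?thesis by simp
qed

lemma filter_upt_eq_prefix:
  assumes "k \<le> N" "\<And>i. 1 \<le> i \<Longrightarrow> i \<le> N \<Longrightarrow> P i \<longleftrightarrow> i \<le> k"
  shows "filter P [1..<N + 1] = [1..<k + 1]"
proof -
  have split: "[1..<N + 1] = [1..<k + 1] @ [k + 1..<N + 1]"
    using upt_add_eq_append[of 1 "k + 1" "N - k"] assms(1) by simp
  have "filter P [1..<k + 1] = [1..<k + 1]"
    by (rule filter_True) (use assms in \<open>auto simp del: upt_Suc\<close>)
  moreover have "filter P [k + 1..<N + 1] = []"
    by (rule filter_False) (use assms(2) in \<open>fastforce simp del: upt_Suc\<close>)
  ultimately show ?thesis unfolding split filter_append by simp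
qed

lemma filter_upt_downset:
  assumes "\<And>i j. P i \<Longrightarrow> 1 \<le> j \<Longrightarrow> j \<le> i \<Longrightarrow> i \<le> N \<Longrightarrow> P j"
    and "length (filter P [1..<N + 1]) = k"
  shows "k \<le> N" and "\<And>i. 1 \<le> i \<Longrightarrow> i \<le> N \<Longrightarrow> P i \<longleftrightarrow> i \<le> k"
    and "filter P [1..<N + 1] = [1..<k + 1]"
proof -
  let ?S = "{i. i < N \<and> P (Suc i)}"
  have "length (filter P [1..<N + 1]) = card (set (filter P [1..<N + 1]))"
    by (metis distinct_card distinct_filter distinct_upt)
  also have "set (filter P [1..<N + 1]) = Suc ` ?S"
  proof (intro set_eqI)
    show "i \<in> set (filter P [1..<N + 1]) \<longleftrightarrow> i \<in> Suc ` ?S" for i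
      by (cases i) (auto simp del: upt_Suc)
  qed
  also have "card (Suc ` ?S) = card ?S" by (simp add: card_image)
  finally have card: "card ?S = k" using assms(2) by simp
  have S: "?S = {..<k}"
  proof -
    have "j \<in> ?S" if "i \<in> ?S" "j \<le> i" for i j
      using that assms(1)[of "Suc i" "Suc j"] by simp
    then show ?thesis using downset_eq_lessThan_card[of ?S] card by simp
  qed
  show kN: "k \<le> N"
    using card card_mono[of "{..<N}" ?S] by auto
  show P: "P i \<longleftrightarrow> i \<le> k" if "1 \<le> i" "i \<le> N" for i
    using S that by (cases i) (auto simp: set_eq_iff Suc_le_eq)
  show "filter P [1..<N + 1] = [1..<k + 1]"
    by (rule filter_upt_eq_prefix) (use kN P in auto)
qed

lemma conj_part_antimono: "i \<le> j \<Longrightarrow> conj_part d j \<le> conj_part d i"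
  unfolding conj_part_def by (rule card_mono) auto

lemma conj_part_ge_iff:
  assumes "sorted_wrt (\<ge>) d"
  shows "conj_part d j > i \<longleftrightarrow> i < length d \<and> j \<le> d ! i"
proof -
  let ?S = "{i. i < length d \<and> j \<le> d ! i}"
  have "?S = {..<card ?S}"
  proof (rule downset_eq_lessThan_card)
    show "b \<in> ?S" if "a \<in> ?S" "b \<le> a" for a b
    proof -
      have "d ! a \<le> d ! b"
        using that assms by (cases "a = b") (auto simp: sorted_wrt_iff_nth_less)
      then show ?thesis using that by simp
    qed
  qed simp
  then have "i \<in> ?S \<longleftrightarrow> i < card ?S" by (metis lessThan_iff)
  then show ?thesis by (simp add: conj_part_def)
qed

lemma alpha_of_decomp:
  assumes "sorted_wrt (\<ge>) d" "length (alpha_of d) = k"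
  shows "k \<le> length d" and "\<And>i. i < length d \<Longrightarrow> i < d ! i \<longleftrightarrow> i < k"
    and "\<And>i. i < k \<Longrightarrow> alpha_of d ! i = d ! i - i"
proof -
  have "j \<le> d ! (j - 1)" if "i \<le> d ! (i - 1)" "1 \<le> j" "j \<le> i" "i \<le> length d" for i j
  proof -
    have "d ! (i - 1) \<le> d ! (j - 1)"
      using that assms(1) by (cases "i = j") (auto simp: sorted_wrt_iff_nth_less)
    then show ?thesis using that by simp
  qed
  note f = filter_upt_downset[where P = "\<lambda>i. i \<le> d ! (i - 1)" and N = "length d" and k = k, OF this]
  have len: "length (filter (\<lambda>i. i \<le> d ! (i - 1)) [1..<length d + 1]) = k"
    using assms(2) by (simp add: alpha_of_def)
  show "k \<le> length d" by (rule f(1)) (use len in auto)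
  show iff: "i < d ! i \<longleftrightarrow> i < k" if "i < length d" for i
    using f(2)[OF _ _ _ _ len, where i = "Suc i"] that by (auto simp: Suc_le_eq)
  have "filter (\<lambda>i. i \<le> d ! (i - 1)) [1..<length d + 1] = [1..<k + 1]"
    by (rule f(3)) (use len in auto)
  then have a: "alpha_of d = map (\<lambda>i. d ! (i - 1) - i + 1) [1..<k + 1]" by (simp add: alpha_of_def)
  show "alpha_of d ! i = d ! i - i" if "i < k" for i
    using iff[of i] that \<open>k \<le> length d\<close> unfolding a by (simp del: upt_Suc)
qed

lemma beta_of_decomp:
  fixes d :: "nat list"
  assumes "length (beta_of d) = k"
  shows "\<And>j. j < length d \<Longrightarrow> Suc j < conj_part d (Suc j) \<longleftrightarrow> j < k"
    and "\<And>j. j < k \<Longrightarrow> beta_of d ! j = conj_part d (Suc j) - Suc j"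
proof -
  have "j < conj_part d j" if "i < conj_part d i" "1 \<le> j" "j \<le> i" "i \<le> length d" for i j
    using that conj_part_antimono[of j i d] by linarith
  note f = filter_upt_downset[where P = "\<lambda>j. j < conj_part d j" and N = "length d" and k = k, OF this]
  have len: "length (filter (\<lambda>j. j < conj_part d j) [1..<length d + 1]) = k"
    using assms by (simp add: beta_of_def)
  show "Suc j < conj_part d (Suc j) \<longleftrightarrow> j < k" if "j < length d" for j
    using f(2)[OF _ _ _ _ len, where i = "Suc j"] that by auto
  have "filter (\<lambda>j. j < conj_part d j) [1..<length d + 1] = [1..<k + 1]"
    by (rule f(3)) (use len in auto)
  then have b: "beta_of d = map (\<lambda>j. conj_part d j - j) [1..<k + 1]" by (simp add: beta_of_def)
  show "beta_of d ! j = conj_part d (Suc j) - Suc j" if "j < k" for j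
    using that unfolding b by (simp del: upt_Suc)
qed

lemma sum_conj_part: "(\<Sum>j<k. conj_part d (Suc j)) = (\<Sum>i<length d. min (d ! i) k)"
proof -
  have "(\<Sum>i<length d. min (d ! i) k) = (\<Sum>i<length d. card {j \<in> {..<k}. Suc j \<le> d ! i})"
  proof (rule sum.cong)
    fix i
    have "{j \<in> {..<k}. Suc j \<le> d ! i} = {..<min (d ! i) k}" by auto
    then show "min (d ! i) k = card {j \<in> {..<k}. Suc j \<le> d ! i}" by simp
  qed simp
  also have "\<dots> = (\<Sum>j<k. card {i \<in> {..<length d}. Suc j \<le> d ! i})"
    by (rule sum_multicount_gen) auto
  finally show ?thesis by (simp add: conj_part_def)
qed

text \<open>If \<open>alpha\<close> and \<open>beta\<close> have the same sum then the degree sums satisfy the equality of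
  \<open>split_of_degree_sums\<close>, because the columns of the Ferrers diagram of the degree sequence are
  counted by \<open>sum_conj_part\<close>.  So the graph is split, with the \<open>k\<close> vertices of largest degree as
  clique.  That \<open>beta\<close> has \<open>k\<close> parts provides one more vertex of degree \<open>k\<close>, and since
  it lies in the stable part it is adjacent to the whole clique.\<close>

lemma block_of_equal_lengths_split:
  fixes V :: "nat set"
  assumes G: "simple_graph V E" and "0 < k"
    and block: "(alpha_of (degree_sequence V E), beta_of (degree_sequence V E)) \<in> A_blocks n k"
  obtains vs where "distinct vs" "set vs = V" "degree_sequence V E = map (degree E) vs"
    "k < length vs" "\<And>i. k \<le> i \<Longrightarrow> i < length vs \<Longrightarrow> degree E (vs ! i) \<le> k"
    "\<And>i. i \<le> k \<Longrightarrow> k \<le> degree E (vs ! i)" "degree E (vs ! k) = k"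
    "indep (V - set (take k vs)) E" "\<And>i. i < k \<Longrightarrow> {vs ! i, vs ! k} \<in> E"
    "chromatic_number V E = k + 1"
proof -
  have finV: "finite V" using G by (simp add: simple_graph_def)
  obtain vs where vs: "distinct vs" "set vs = V" and sorted: "sorted_wrt (\<ge>) (map (degree E) vs)"
    and seq: "degree_sequence V E = map (degree E) vs"
    using degree_sequence_enumeration[OF finV] by blast
  define d where "d = map (degree E) vs"
  define N where "N = length vs"
  have N: "length d = N" by (simp add: d_def N_def)
  have d_sorted: "sorted_wrt (\<ge>) d" using sorted by (simp add: d_def)
  have blocks: "alpha_of d \<in> Dis_len k n" "beta_of d \<in> Dis_len k n"
    using block by (auto simp: A_blocks_def seq d_def)
  then have len: "length (alpha_of d) = k" "length (beta_of d) = k" by (auto simp: Dis_len_iff)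
  have kN: "k \<le> N" and below: "\<And>i. i < N \<Longrightarrow> i < d ! i \<longleftrightarrow> i < k"
    and alpha: "\<And>i. i < k \<Longrightarrow> alpha_of d ! i = d ! i - i"
    using alpha_of_decomp[OF d_sorted len(1)] by (auto simp: N)
  have conj: "\<And>j. j < N \<Longrightarrow> Suc j < conj_part d (Suc j) \<longleftrightarrow> j < k"
    and beta: "\<And>j. j < k \<Longrightarrow> beta_of d ! j = conj_part d (Suc j) - Suc j"
    using beta_of_decomp[OF len(2)] by (auto simp: N)
  have "k < conj_part d k" using conj[of "k - 1"] kN \<open>0 < k\<close> by simp
  then have kN': "k < N" and "k \<le> d ! k" using conj_part_ge_iff[OF d_sorted, of k k] by (auto simp: N)
  then have dk: "d ! k = k" using below[of k] by simp
  have anti: "d ! j \<le> d ! i" if "i \<le> j" "j < N" for i j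
    using that d_sorted N by (cases "i = j") (auto simp: sorted_wrt_iff_nth_less)
  have small: "d ! i \<le> k" if "k \<le> i" "i < N" for i using anti[OF that] dk by simp
  have large: "k \<le> d ! i" if "i \<le> k" for i using anti[OF that kN'] dk by simp

  have "(\<Sum>i<k. d ! i) = (\<Sum>i<k. alpha_of d ! i + i)"
  proof (rule sum.cong)
    fix i assume "i \<in> {..<k}"
    then show "d ! i = alpha_of d ! i + i" using alpha[of i] below[of i] kN by simp
  qed simp
  then have alpha_sum: "(\<Sum>i<k. d ! i) = n + (\<Sum>i<k. i)"
    using blocks(1) by (simp add: Dis_len_iff sum.distrib)
  have "(\<Sum>j<k. conj_part d (Suc j)) = (\<Sum>j<k. beta_of d ! j + Suc j)"
  proof (rule sum.cong)
    fix j assume "j \<in> {..<k}"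
    then show "conj_part d (Suc j) = beta_of d ! j + Suc j" using beta[of j] conj[of j] kN by simp
  qed simp
  then have beta_sum: "(\<Sum>j<k. conj_part d (Suc j)) = n + ((\<Sum>i<k. i) + k)"
    using blocks(2) by (simp add: Dis_len_iff sum.distrib sum_Suc)
  have "(\<Sum>i<N. min (d ! i) k) = (\<Sum>i<k. min (d ! i) k) + (\<Sum>i\<in>{k..<N}. min (d ! i) k)"
    using sum.atLeastLessThan_concat[of 0 k N] kN by (metis lessThan_atLeast0 zero_le)
  also have "(\<Sum>i<k. min (d ! i) k) = (\<Sum>i<k. k)"
    by (rule sum.cong) (use large in auto)
  also have "(\<Sum>i\<in>{k..<N}. min (d ! i) k) = (\<Sum>i\<in>{k..<N}. d ! i)"
    by (rule sum.cong) (use small in auto)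
  finally have ferrers: "n + ((\<Sum>i<k. i) + k) = k * k + (\<Sum>i\<in>{k..<N}. d ! i)"
    using beta_sum sum_conj_part[of d k] by (simp add: N)

  define T where "T = set (take k vs)"
  have T_nth: "T = (!) vs ` {..<k}"
    using kN nth_image[of k vs] by (simp add: T_def N_def lessThan_atLeast0)
  have V_nth: "V = (!) vs ` {..<N}"
    using nth_image[of N vs] vs(2) by (simp add: N_def lessThan_atLeast0)
  have inj: "inj_on ((!) vs) {..<N}"
    using inj_on_nth[OF vs(1)] by (simp add: N_def)
  have rest: "V - T = (!) vs ` {k..<N}"
  proof -
    have "{..<N} - {..<k} = {k..<N}" by auto
    moreover have "(!) vs ` ({..<N} - {..<k}) = (!) vs ` {..<N} - (!) vs ` {..<k}"
      by (rule inj_on_image_set_diff[OF inj]) (use kN in auto)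
    ultimately show ?thesis by (simp add: V_nth T_nth)
  qed
  have TV: "T \<subseteq> V" unfolding T_nth V_nth using kN by auto
  have injk: "inj_on ((!) vs) {..<k}" "inj_on ((!) vs) {k..<N}"
    using kN by (auto intro: inj_on_subset[OF inj])
  have cardT: "card T = k" unfolding T_nth using card_image[OF injk(1)] by simp
  have "(\<Sum>v\<in>T. degree E v) = (\<Sum>i<k. d ! i)"
    unfolding T_nth by (subst sum.reindex[OF injk(1)], rule sum.cong)
      (use kN in \<open>auto simp: d_def N_def\<close>)
  moreover have "(\<Sum>v\<in>V - T. degree E v) = (\<Sum>i\<in>{k..<N}. d ! i)"
    unfolding rest by (subst sum.reindex[OF injk(2)], rule sum.cong) (auto simp: d_def N_def)
  ultimately have "(\<Sum>v\<in>T. degree E v) + k = (\<Sum>v\<in>V - T. degree E v) + k * k"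
    using alpha_sum ferrers by simp
  then have split: "clique T E" "indep (V - T) E"
    using split_of_degree_sums[OF G TV cardT] by auto

  have vk: "vs ! k \<in> V - T" using rest kN' by auto
  have "{u \<in> V. {u, vs ! k} \<in> E} \<subseteq> T"
  proof
    fix u assume "u \<in> {u \<in> V. {u, vs ! k} \<in> E}"
    then have u: "u \<in> V" "{u, vs ! k} \<in> E" by auto
    then have "u \<noteq> vs ! k" using not_edge_self[OF G] by auto
    then show "u \<in> T" using split(2) vk u unfolding indep_def by blast
  qed
  moreover have "card {u \<in> V. {u, vs ! k} \<in> E} = card T"
    using degree_eq_card_neighbours[OF G, of "vs ! k"] vk dk kN' cardT by (simp add: d_def N_def)
  moreover have "finite T" using TV finV finite_subset by blast
  ultimately have "{u \<in> V. {u, vs ! k} \<in> E} = T" by (intro card_subset_eq)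
  then have joined: "{t, vs ! k} \<in> E" if "t \<in> T" for t using that by blast
  have "chromatic_number V E = k + 1"
    using chromatic_number_split[OF G TV split vk joined] cardT by simp
  moreover have "{vs ! i, vs ! k} \<in> E" if "i < k" for i using joined that T_nth by blast
  moreover have "degree E (vs ! i) \<le> k" if "k \<le> i" "i < length vs" for i
    using small[of i] that by (simp add: d_def N_def)
  moreover have "k \<le> degree E (vs ! i)" if "i \<le> k" for i
    using large[of i] that kN' by (simp add: d_def N_def)
  moreover have "k < length vs" "degree E (vs ! k) = k" using kN' dk by (simp_all add: d_def N_def)
  moreover have "indep (V - set (take k vs)) E" using split(2) by (simp add: T_def)
  ultimately show ?thesis using that[OF vs seq] by blast
qed

text \<open>The vertices of degree \<open>k\<close> outside the clique are pairwise not adjacent, so if they form a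
  clique there is only one of them, and \<open>k + 1\<close> vertices in all have degree at least \<open>k\<close>.\<close>

lemma NG1_block_last_beta:
  assumes "X \<in> A_blocks n k" "0 < k" "NG1_block X"
  shows "last (snd X) = 1"
proof -
  obtain V :: "nat set" and E where NG: "NG1_graph V E"
    and X: "X = (alpha_of (degree_sequence V E), beta_of (degree_sequence V E))"
    using assms(3) by (auto simp: NG1_block_def)
  then have G: "simple_graph V E" by (simp add: NG1_graph_def NG_graph_def)
  obtain vs where vs: "distinct vs" "set vs = V" "degree_sequence V E = map (degree E) vs"
    "k < length vs" "\<And>i. k \<le> i \<Longrightarrow> i < length vs \<Longrightarrow> degree E (vs ! i) \<le> k"
    "\<And>i. i \<le> k \<Longrightarrow> k \<le> degree E (vs ! i)" "degree E (vs ! k) = k"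
    "indep (V - set (take k vs)) E" "\<And>i. i < k \<Longrightarrow> {vs ! i, vs ! k} \<in> E"
    "chromatic_number V E = k + 1"
    by (rule block_of_equal_lengths_split[OF G assms(2) assms(1)[unfolded X]]) (rule that; assumption)
  have A: "A_set V E = {v \<in> V. degree E v = k}" using vs(10) by (auto simp: A_set_def)
  have not_first: "vs ! i \<notin> set (take k vs)" if "k \<le> i" "i < length vs" for i
    using that vs(1,4) by (auto simp: in_set_conv_nth nth_eq_iff_index_eq)
  have "degree E (vs ! i) < k" if i: "k < i" "i < length vs" for i
  proof (rule ccontr)
    assume "\<not> ?thesis"
    then have "degree E (vs ! i) = k" using vs(5)[of i] i by simp
    moreover have "vs ! i \<in> V" "vs ! k \<in> V" using nth_mem[of _ vs] vs(2,4) i by auto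
    ultimately have "vs ! i \<in> A_set V E" "vs ! k \<in> A_set V E" using A vs(7) by simp_all
    moreover have "vs ! i \<noteq> vs ! k" using i vs(1,4) by (simp add: nth_eq_iff_index_eq)
    ultimately have "{vs ! i, vs ! k} \<in> E" using NG by (auto simp: NG1_graph_def clique_def)
    moreover have "{vs ! i, vs ! k} \<notin> E"
      using vs(2,4,8) not_first[of i] not_first[of k] i \<open>vs ! i \<noteq> vs ! k\<close> by (auto simp: indep_def)
    ultimately show False by simp
  qed
  then have "{i. i < length vs \<and> k \<le> degree E (vs ! i)} = {..k}"
    using vs(4,6) by (auto simp: not_less[symmetric])
  then have "conj_part (degree_sequence V E) k = k + 1"
    unfolding vs(3) conj_part_def by (simp add: nth_map cong: conj_cong)
  moreover have len: "length (snd X) = k" using assms(1) by (auto simp: A_blocks_def Dis_len_def)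
  then have "snd X ! (k - 1) = conj_part (degree_sequence V E) (Suc (k - 1)) - Suc (k - 1)"
    using beta_of_decomp(2)[of "degree_sequence V E" k "k - 1"] assms(2) X by simp
  moreover have "last (snd X) = snd X ! (k - 1)" using len assms(2) by (subst last_conv_nth) auto
  ultimately show ?thesis using assms(2) by simp
qed

text \<open>The vertex of degree \<open>k\<close> outside the clique is adjacent to the whole clique.  So if the
  vertices of degree \<open>k\<close> are stable, all degrees in the clique exceed \<open>k\<close>.\<close>

lemma NG2_block_last_alpha:
  assumes "X \<in> A_blocks n k" "0 < k" "NG2_block X"
  shows "2 \<le> last (fst X)"
proof -
  obtain V :: "nat set" and E where NG: "NG2_graph V E"
    and X: "X = (alpha_of (degree_sequence V E), beta_of (degree_sequence V E))"
    using assms(3) by (auto simp: NG2_block_def)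
  then have G: "simple_graph V E" by (simp add: NG2_graph_def NG_graph_def)
  obtain vs where vs: "distinct vs" "set vs = V" "degree_sequence V E = map (degree E) vs"
    "k < length vs" "\<And>i. k \<le> i \<Longrightarrow> i < length vs \<Longrightarrow> degree E (vs ! i) \<le> k"
    "\<And>i. i \<le> k \<Longrightarrow> k \<le> degree E (vs ! i)" "degree E (vs ! k) = k"
    "indep (V - set (take k vs)) E" "\<And>i. i < k \<Longrightarrow> {vs ! i, vs ! k} \<in> E"
    "chromatic_number V E = k + 1"
    by (rule block_of_equal_lengths_split[OF G assms(2) assms(1)[unfolded X]]) (rule that; assumption)
  have A: "A_set V E = {v \<in> V. degree E v = k}" using vs(10) by (auto simp: A_set_def)
  have "degree E (vs ! (k - 1)) \<noteq> k"
  proof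
    assume "degree E (vs ! (k - 1)) = k"
    moreover have "vs ! (k - 1) \<in> V" "vs ! k \<in> V" using nth_mem[of _ vs] vs(2,4) by auto
    ultimately have "vs ! (k - 1) \<in> A_set V E" "vs ! k \<in> A_set V E" using A vs(7) by simp_all
    moreover have "vs ! (k - 1) \<noteq> vs ! k" using assms(2) vs(1,4) by (simp add: nth_eq_iff_index_eq)
    ultimately show False using NG vs(9)[of "k - 1"] assms(2) by (auto simp: NG2_graph_def indep_def)
  qed
  then have "k < degree E (vs ! (k - 1))" using vs(6)[of "k - 1"] by simp
  then have "k < degree_sequence V E ! (k - 1)" using vs(3,4) by simp
  moreover have "sorted_wrt (\<ge>) (degree_sequence V E)"
    by (simp add: degree_sequence_def sorted_wrt_rev)
  moreover have len: "length (fst X) = k" using assms(1) by (auto simp: A_blocks_def Dis_len_def)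
  ultimately have "2 \<le> fst X ! (k - 1)"
    using alpha_of_decomp(3)[of "degree_sequence V E" k "k - 1"] assms(2) X by simp
  moreover have "last (fst X) = fst X ! (k - 1)" using len assms(2) by (subst last_conv_nth) auto
  ultimately show ?thesis by simp
qed

section \<open>Realizing a block\<close>

text \<open>The rows of a 0-1 matrix, given as the sets \<open>M i\<close> of columns, can be brought to any antitone
  sequence of sizes that they dominate, without changing the sizes of the columns; for a Ferrers
  diagram \<open>M\<close> this is the sufficiency part of the Gale--Ryser theorem.  Let \<open>j\<close> be the first row with fewer than \<open>a j\<close> entries.
  By dominance some earlier row \<open>i\<close> has more than \<open>a i\<close>, so it has an entry in a column in
  which row \<open>j\<close> has none.  Moving this entry to row \<open>j\<close> preserves dominance, since all rows
  before \<open>j\<close> still have at least the required size.\<close>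

lemma gale_ryser:
  fixes a :: "nat \<Rightarrow> nat" and M :: "nat \<Rightarrow> 'a set"
  assumes anti: "\<And>i j. i \<le> j \<Longrightarrow> j < k \<Longrightarrow> a j \<le> a i"
    and "\<And>i. i < k \<Longrightarrow> finite (M i)"
    and "\<And>m. m \<le> k \<Longrightarrow> (\<Sum>i<m. a i) \<le> (\<Sum>i<m. card (M i))"
    and "(\<Sum>i<k. a i) = (\<Sum>i<k. card (M i))"
  shows "\<exists>M'. (\<forall>i<k. finite (M' i) \<and> card (M' i) = a i) \<and>
    (\<forall>c. card {i. i < k \<and> c \<in> M' i} = card {i. i < k \<and> c \<in> M i})"
  using assms(2-4)
proof (induction "\<Sum>i<k. card (M i) - a i" arbitrary: M rule: less_induct)
  case less
  note fin = less.prems(1) and dom = less.prems(2) and total = less.prems(3)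
  show ?case
  proof (cases "\<exists>j<k. card (M j) < a j")
    case False
    then have "a i \<le> card (M i)" if "i < k" for i using that not_less by blast
    then have "a i = card (M i)" if "i < k" for i
      using sum_mono_inv[OF total, of i] that by simp
    then show ?thesis using fin by (intro exI[of _ M]) auto
  next
    case True
    define j where "j = (LEAST j. j < k \<and> card (M j) < a j)"
    have j: "j < k" "card (M j) < a j" using LeastI_ex[OF True] by (auto simp: j_def)
    have before: "a t \<le> card (M t)" if "t < j" for t
      using not_less_Least[OF that[unfolded j_def]] that j(1) by auto
    have "\<exists>i<j. a i < card (M i)"
    proof (rule ccontr)
      assume "\<not> ?thesis"
      then have "card (M t) \<le> a t" if "t < j" for t using that not_less by blast
      then have "(\<Sum>t<j. card (M t)) \<le> (\<Sum>t<j. a t)" by (intro sum_mono) simp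
      then show False using dom[of "Suc j"] j by simp
    qed
    then obtain i where i: "i < j" "a i < card (M i)" by blast
    have "card (M j) < card (M i)" using i j anti[of i j] by simp
    then have "\<not> M i \<subseteq> M j" using card_mono[OF fin[OF j(1)]] by (meson not_le)
    then obtain c where c: "c \<in> M i" "c \<notin> M j" by blast
    define M2 where "M2 = M(i := M i - {c}, j := insert c (M j))"
    have ik: "i < k" using i j by simp
    have M2: "M2 i = M i - {c}" "M2 j = insert c (M j)" "\<And>t. t \<noteq> i \<Longrightarrow> t \<noteq> j \<Longrightarrow> M2 t = M t"
      using i by (auto simp: M2_def)
    have card_M2: "card (M2 i) = card (M i) - 1" "card (M2 j) = card (M j) + 1"
      using fin[OF ik] fin[OF j(1)] c by (auto simp: M2)
    have fin2: "finite (M2 t)" if "t < k" for t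
      using fin[OF that] by (auto simp: M2_def)
    have sum_M2: "(\<Sum>t<m. card (M2 t)) = (\<Sum>t<m. card (M t))" if "j < m" for m
    proof -
      have split: "(\<Sum>t<m. f t) = f i + (f j + (\<Sum>t\<in>{..<m} - {i} - {j}. f t))" for f :: "nat \<Rightarrow> nat"
      proof -
        have "(\<Sum>t<m. f t) = f i + (\<Sum>t\<in>{..<m} - {i}. f t)"
          by (rule sum.remove) (use that i in auto)
        also have "(\<Sum>t\<in>{..<m} - {i}. f t) = f j + (\<Sum>t\<in>{..<m} - {i} - {j}. f t)"
          by (rule sum.remove) (use that i in auto)
        finally show ?thesis .
      qed
      have "(\<Sum>t\<in>{..<m} - {i} - {j}. card (M2 t)) = (\<Sum>t\<in>{..<m} - {i} - {j}. card (M t))"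
        by (rule sum.cong) (auto simp: M2)
      then show ?thesis using i card_M2 by (simp add: split)
    qed
    have dom2: "(\<Sum>t<m. a t) \<le> (\<Sum>t<m. card (M2 t))" if "m \<le> k" for m
    proof (cases "j < m")
      case True
      then show ?thesis using sum_M2 dom[OF that] by simp
    next
      case False
      show ?thesis
      proof (rule sum_mono)
        fix t assume "t \<in> {..<m}"
        then have "t < j" using False by simp
        then show "a t \<le> card (M2 t)"
          using before[of t] i card_M2 M2(3)[of t] by (cases "t = i") auto
      qed
    qed
    have "(\<Sum>t<k. card (M2 t) - a t) < (\<Sum>t<k. card (M t) - a t)"
    proof (rule sum_strict_mono_ex1)
      show "\<forall>t\<in>{..<k}. card (M2 t) - a t \<le> card (M t) - a t"
      proof
        fix t
        show "card (M2 t) - a t \<le> card (M t) - a t"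
          using card_M2 M2(3)[of t] j by (cases "t = i \<or> t = j") auto
      qed
      show "\<exists>t\<in>{..<k}. card (M2 t) - a t < card (M t) - a t"
        using ik i card_M2 by (intro bexI[of _ i]) auto
    qed simp
    moreover have "(\<Sum>t<k. a t) = (\<Sum>t<k. card (M2 t))" using sum_M2[OF j(1)] total by simp
    ultimately have "\<exists>M'. (\<forall>i<k. finite (M' i) \<and> card (M' i) = a i) \<and>
        (\<forall>c. card {i. i < k \<and> c \<in> M' i} = card {i. i < k \<and> c \<in> M2 i})"
      using less.hyps[of M2] fin2 dom2 by blast
    moreover have "card {t. t < k \<and> x \<in> M2 t} = card {t. t < k \<and> x \<in> M t}" for x
    proof (cases "x = c")
      case True
      let ?S = "{t. t < k \<and> c \<in> M t}"
      have "{t. t < k \<and> c \<in> M2 t} = insert j (?S - {i})"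
        using j i c by (auto simp: M2_def)
      moreover have S: "i \<in> ?S" "j \<notin> ?S - {i}" "finite ?S" using c ik by auto
      moreover have "card (insert j (?S - {i})) = Suc (card (?S - {i}))"
        using S by (intro card_insert_disjoint) auto
      ultimately show ?thesis using True card_Suc_Diff1[OF S(3,1)] by simp
    next
      case False
      then show ?thesis by (auto simp: M2_def intro!: arg_cong[where f = card])
    qed
    ultimately show ?thesis by simp
  qed
qed

text \<open>The graph is split: the clique is \<open>{..<k}\<close>, the vertex \<open>k\<close> is adjacent to exactly the
  clique, and the further vertices up to \<open>b ! 0\<close> form the columns of a matrix obtained from
  \<open>gale_ryser\<close>.  The starting rows \<open>{k + 1..b ! i + i}\<close> form a Ferrers diagram, which gives the
  columns the sizes that \<open>beta\<close> prescribes, while the redistribution gives the rows those that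
  \<open>alpha\<close> prescribes; after subtraction of a staircase, \<open>b\<close> still majorizes \<open>a\<close>.  The last
  part of \<open>a\<close> makes the degrees in the clique exceed \<open>k\<close> and the last part of \<open>b\<close> makes those
  of the columns smaller than \<open>k\<close>, so \<open>k\<close> is the only vertex of degree \<open>k\<close>.\<close>

lemma NG_blocks_of_last_parts:
  assumes block: "(a, b) \<in> A_blocks n k" and "0 < k" and last: "2 \<le> last a" "last b = 1"
  shows "NG1_block (a, b) \<and> NG2_block (a, b)"
proof -
  have len: "length a = k" "length b = k" and Dis: "a \<in> Dis n" "b \<in> Dis n" and maj: "majorizes b a"
    using block by (auto simp: A_blocks_def S_Block_def Dis_len_def)
  have sums: "(\<Sum>i<k. a ! i) = n" "(\<Sum>i<k. b ! i) = n"
    using block by (simp_all add: A_blocks_def Dis_len_iff)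
  have a_anti: "a ! j + j \<le> a ! i + i" if "i \<le> j" "j < k" for i j
    using Dis_nth_gap[OF Dis(1) that(1)] that(2) len by simp
  have b_anti: "b ! j + j \<le> b ! i + i" if "i \<le> j" "j < k" for i j
    using Dis_nth_gap[OF Dis(2) that(1)] that(2) len by simp
  have last_nth: "2 \<le> a ! (k - 1)" "b ! (k - 1) = 1"
    using last len \<open>0 < k\<close> by (metis last_conv_nth length_greater_0_conv)+
  have a_gt: "k < a ! i + i" if "i < k" for i
  proof -
    have "a ! (k - 1) + (k - 1) \<le> a ! i + i" using that by (intro a_anti) auto
    then show ?thesis using last_nth that by linarith
  qed
  have b_ge: "k \<le> b ! i + i" if "i < k" for i
  proof -
    have "b ! (k - 1) + (k - 1) \<le> b ! i + i" using that by (intro b_anti) auto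
    then show ?thesis using last_nth that by linarith
  qed
  define M0 where "M0 i = {k + 1..<b ! i + i + 1}" for i
  \<comment> \<open>The clique and the vertex \<open>k\<close> provide \<open>k\<close> of the required degree \<open>a ! i + i\<close>, so \<open>a ! i + i - k\<close>
    remains for row \<open>i\<close>.  The same shift of \<open>b\<close> gives the sizes of the rows \<open>M0 i\<close>, and it
    changes all partial sums by amounts that do not depend on the partition.\<close>
  have ext: "(\<Sum>i<m. l ! i + i - k) + m * k = (\<Sum>i<m. l ! i) + (\<Sum>i<m. i)"
    if "m \<le> k" "\<And>i. i < k \<Longrightarrow> k \<le> l ! i + i" for m and l :: "nat list"
  proof -
    have "(\<Sum>i<m. l ! i + i) = (\<Sum>i<m. (l ! i + i - k) + k)"
      by (rule sum.cong) (use that in auto)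
    then show ?thesis by (simp add: sum.distrib)
  qed
  have "\<exists>M. (\<forall>i<k. finite (M i) \<and> card (M i) = a ! i + i - k) \<and>
    (\<forall>c. card {i. i < k \<and> c \<in> M i} = card {i. i < k \<and> c \<in> M0 i})"
  proof (rule gale_ryser)
    show "a ! j + j - k \<le> a ! i + i - k" if "i \<le> j" "j < k" for i j
      using a_anti[OF that] by simp
    show "(\<Sum>i<m. a ! i + i - k) \<le> (\<Sum>i<m. card (M0 i))" if "m \<le> k" for m
    proof -
      have "(\<Sum>i<m. a ! i) \<le> (\<Sum>i<m. b ! i)"
        using maj that len by (simp add: majorizes_iff_sum)
      then show ?thesis
        using ext[OF that, of a] ext[OF that, of b] a_gt b_ge by (simp add: M0_def less_imp_le)
    qed
    show "(\<Sum>i<k. a ! i + i - k) = (\<Sum>i<k. card (M0 i))"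
      using ext[of k a] ext[of k b] a_gt b_ge sums by (simp add: M0_def less_imp_le)
  qed (simp add: M0_def)
  then obtain M where M: "\<And>i. i < k \<Longrightarrow> finite (M i)" "\<And>i. i < k \<Longrightarrow> card (M i) = a ! i + i - k"
    "\<And>c. card {i. i < k \<and> c \<in> M i} = card {i. i < k \<and> c \<in> M0 i}" by blast
  have k_le: "k \<le> b ! 0" using b_ge[of 0] \<open>0 < k\<close> by simp
  have M_bound: "k < c \<and> c \<le> b ! 0" if "i < k" "c \<in> M i" for i c
  proof -
    have "0 < card {i. i < k \<and> c \<in> M i}" using that by (auto simp: card_gt_0_iff)
    then have "{i. i < k \<and> c \<in> M0 i} \<noteq> {}" using M(3)[of c] by (metis card.empty less_irrefl)
    then obtain i' where "i' < k" "c \<in> M0 i'" by auto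
    then show ?thesis using b_anti[of 0 i'] by (auto simp: M0_def)
  qed

  define N where "N = b ! 0 + 1"
  define V where "V = {..<N}"
  define E where "E = {{u, v} | u v. u < k \<and> u < v \<and> (v \<le> k \<or> v \<in> M u)}"
  have edge: "{x, y} \<in> E \<longleftrightarrow> x < k \<and> (y \<le> k \<or> y \<in> M x)" if "x < y" for x y
    using that by (auto simp: E_def doubleton_eq_iff)
  have noloop: "{x} \<notin> E" for x
    by (auto simp: E_def)
  have edge': "{x, y} \<in> E \<longleftrightarrow> y < k \<and> (x \<le> k \<or> x \<in> M y)" if "y < x" for x y
    using edge[OF that] by (simp add: insert_commute)
  have G: "simple_graph V E"
    using M_bound k_le by (auto simp: simple_graph_def V_def E_def N_def) fastforce+

  \<comment> \<open>The rows that reach column \<open>v\<close> in the Ferrers diagram form an initial segment, so its size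
    \<open>f v\<close> determines them.\<close>
  define f where "f v = card {i. i < k \<and> v \<le> b ! i + i}" for v
  have f: "i < f v \<longleftrightarrow> i < k \<and> v \<le> b ! i + i" for i v
  proof -
    have "{i. i < k \<and> v \<le> b ! i + i} = {..<f v}"
      unfolding f_def by (rule downset_eq_lessThan_card) (auto intro: order.trans[OF _ b_anti])
    then show ?thesis by blast
  qed
  have f_le: "f v \<le> k" for v using f[of k v] by simp
  have f_less: "f v < k" if "k < v" for v
    using f[of "k - 1" v] that last_nth \<open>0 < k\<close> by simp
  have deg_clique: "degree E u = a ! u + u" if "u < k" for u
  proof -
    have "{x \<in> V. {x, u} \<in> E} = ({..k} - {u}) \<union> M u"
    proof (intro set_eqI)
      show "x \<in> {x \<in> V. {x, u} \<in> E} \<longleftrightarrow> x \<in> ({..k} - {u}) \<union> M u" for x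
        using that edge[of x u] edge'[of u x] noloop[of u] M_bound[of u x] k_le
        by (cases x u rule: linorder_cases) (auto simp: V_def N_def)
    qed
    moreover have "({..k} - {u}) \<inter> M u = {}" using M_bound[OF that] by fastforce
    ultimately have "degree E u = card ({..k} - {u}) + card (M u)"
      using degree_eq_card_neighbours[OF G, of u] that k_le M(1)[OF that]
      by (simp add: V_def N_def card_Un_disjoint)
    then show ?thesis using M(2)[OF that] a_gt[OF that] that by simp
  qed
  have deg_k: "degree E k = k"
  proof -
    have "{x \<in> V. {x, k} \<in> E} = {..<k}"
    proof (intro set_eqI)
      show "x \<in> {x \<in> V. {x, k} \<in> E} \<longleftrightarrow> x \<in> {..<k}" for x
        using edge[of x k] edge'[of k x] noloop[of k] k_le
        by (cases x k rule: linorder_cases) (auto simp: V_def N_def)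
    qed
    then show ?thesis using degree_eq_card_neighbours[OF G, of k] k_le by (simp add: V_def N_def)
  qed
  have deg_col: "degree E v = f v" if "k < v" "v < N" for v
  proof -
    have "{x \<in> V. {x, v} \<in> E} = {i. i < k \<and> v \<in> M i}"
    proof (intro set_eqI)
      show "x \<in> {x \<in> V. {x, v} \<in> E} \<longleftrightarrow> x \<in> {i. i < k \<and> v \<in> M i}" for x
        using that edge[of x v] edge'[of v x] noloop[of v]
        by (cases x v rule: linorder_cases) (auto simp: V_def)
    qed
    moreover have "{i. i < k \<and> v \<in> M0 i} = {i. i < k \<and> v \<le> b ! i + i}"
      using that by (auto simp: M0_def)
    ultimately show ?thesis
      using degree_eq_card_neighbours[OF G, of v] M(3)[of v] that by (simp add: V_def f_def)
  qed

  define d where "d = map (degree E) [0..<N]"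
  have kN: "k < N" using k_le by (simp add: N_def)
  have len_d: "length d = N" and d_nth: "\<And>i. i < N \<Longrightarrow> d ! i = degree E i"
    by (auto simp: d_def simp del: upt_Suc)
  have sorted: "sorted_wrt (\<ge>) d"
    unfolding sorted_wrt_iff_nth_less len_d
  proof (intro allI impI)
    fix u v assume uv: "u < v" "v < N"
    consider "v < k" | "u < k" "v = k" | "u < k" "k < v" | "u = k" "k < v" | "k < u"
      using uv by linarith
    then have "degree E v \<le> degree E u"
    proof cases
      case 3
      then show ?thesis using uv a_gt[of u] f_le[of v] by (simp add: deg_clique deg_col)
    next
      case 5
      have "f v \<le> f u" unfolding f_def by (rule card_mono) (use uv in auto)
      then show ?thesis using 5 uv by (simp add: deg_col)
    qed (use uv a_anti[of u v] a_gt[of u] f_le[of v] in \<open>auto simp: deg_clique deg_k deg_col\<close>)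
    then show "d ! v \<le> d ! u" using uv by (simp add: d_nth)
  qed
  have seq: "degree_sequence V E = d"
    unfolding d_def by (rule degree_sequence_eqI) (use sorted in \<open>auto simp: V_def d_def\<close>)

  have "filter (\<lambda>i. i \<le> d ! (i - 1)) [1..<N + 1] = [1..<k + 1]"
  proof (rule filter_upt_eq_prefix)
    fix i assume i: "1 \<le> i" "i \<le> N"
    consider "i \<le> k" | "i = k + 1" | "k < i - 1" by linarith
    then show "i \<le> d ! (i - 1) \<longleftrightarrow> i \<le> k"
    proof cases
      case 1
      then have "d ! (i - 1) = a ! (i - 1) + (i - 1)" "k < a ! (i - 1) + (i - 1)"
        using i kN by (simp_all only: d_nth deg_clique a_gt)
      then show ?thesis using 1 by linarith
    next
      case 3
      then have "d ! (i - 1) \<le> k" using i f_le[of "i - 1"] by (simp add: d_nth deg_col)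
      then show ?thesis using 3 by linarith
    qed (use kN in \<open>simp add: d_nth deg_k\<close>)
  qed (use kN in simp)
  then have alpha: "alpha_of d = map (\<lambda>i. d ! (i - 1) - i + 1) [1..<k + 1]"
    by (simp add: alpha_of_def len_d)
  have "alpha_of d = a"
  proof (rule nth_equalityI)
    fix i assume "i < length (alpha_of d)"
    then have "i < k" by (simp add: alpha del: upt_Suc)
    then show "alpha_of d ! i = a ! i"
      using kN a_gt[of i] by (simp add: alpha d_nth deg_clique del: upt_Suc)
  qed (simp add: alpha len del: upt_Suc)

  have "filter (\<lambda>j. j < conj_part d j) [1..<N + 1] = [1..<k + 1]"
  proof (rule filter_upt_eq_prefix)
    fix j
    consider "j < k" | "j = k" | "k < j" by linarith
    then show "j < conj_part d j \<longleftrightarrow> j \<le> k"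
      unfolding conj_part_ge_iff[OF sorted] len_d
    proof cases
      case 3
      then show "j < N \<and> j \<le> d ! j \<longleftrightarrow> j \<le> k" using f_le[of j] by (auto simp: d_nth deg_col)
    qed (use kN in \<open>simp_all add: d_nth deg_clique deg_k\<close>)
  qed (use kN in simp)
  then have beta: "beta_of d = map (\<lambda>j. conj_part d j - j) [1..<k + 1]"
    by (simp add: beta_of_def len_d)
  have conj: "conj_part d (Suc j) = b ! j + Suc j" if j: "j < k" for j
  proof -
    have "i < conj_part d (Suc j) \<longleftrightarrow> i < b ! j + Suc j" for i
    proof -
      consider "i < k" | "i = k" | "k < i" by linarith
      then show ?thesis
        unfolding conj_part_ge_iff[OF sorted] len_d
      proof cases
        case 1
        then show "i < N \<and> Suc j \<le> d ! i \<longleftrightarrow> i < b ! j + Suc j"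
          using j kN a_gt[of i] b_ge[of j] by (simp add: d_nth deg_clique)
      next
        case 2
        then show "i < N \<and> Suc j \<le> d ! i \<longleftrightarrow> i < b ! j + Suc j"
          using j kN b_ge[of j] by (simp add: d_nth deg_k)
      next
        case 3
        have "b ! j + Suc j \<le> N" using b_anti[of 0 j] j by (simp add: N_def)
        then show "i < N \<and> Suc j \<le> d ! i \<longleftrightarrow> i < b ! j + Suc j"
          using 3 j f[of j i] by (auto simp: d_nth deg_col Suc_le_eq)
      qed
    qed
    then show ?thesis by (meson linorder_neqE_nat less_irrefl)
  qed
  have "beta_of d = b"
  proof (rule nth_equalityI)
    fix j assume "j < length (beta_of d)"
    then have "j < k" by (simp add: beta del: upt_Suc)
    then show "beta_of d ! j = b ! j" using conj[of j] by (simp add: beta del: upt_Suc)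
  qed (simp add: beta len del: upt_Suc)

  have split: "{..<k} \<subseteq> V" "clique {..<k} E" "indep (V - {..<k}) E" "k \<in> V - {..<k}"
    "\<And>t. t \<in> {..<k} \<Longrightarrow> {t, k} \<in> E"
  proof -
    show "clique {..<k} E" unfolding clique_def
    proof (intro ballI impI)
      fix v w assume "v \<in> {..<k}" "w \<in> {..<k}" "v \<noteq> w"
      then show "{v, w} \<in> E" using edge[of v w] edge'[of w v]
        by (cases v w rule: linorder_cases) auto
    qed
    show "indep (V - {..<k}) E" by (auto simp: indep_def E_def doubleton_eq_iff)
  qed (use kN edge in \<open>auto simp: V_def\<close>)
  have chi: "chromatic_number V E = k + 1"
    using chromatic_number_split[OF G split] by simp
  have chi': "chromatic_number V (complement_edges V E) = N - k"
    using chromatic_number_complement_split[OF G split] by (simp add: V_def)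
  have "no_isolated V E"
    unfolding no_isolated_def
  proof
    fix v assume "v \<in> V"
    then have v: "v < N" by (simp add: V_def)
    consider "v < k" | "v = k" | "k < v" by linarith
    then show "0 < degree E v"
    proof cases
      case 3
      then show ?thesis using v f[of 0 v] \<open>0 < k\<close> by (simp add: deg_col N_def)
    qed (use \<open>0 < k\<close> a_gt[of v] in \<open>simp_all add: deg_clique deg_k\<close>)
  qed
  then have NG: "NG_graph V E" using G chi chi' kN by (simp add: NG_graph_def V_def)
  have "A_set V E \<subseteq> {k}"
  proof
    fix v assume v: "v \<in> A_set V E"
    then have "v < N" "degree E v = k" using chi by (auto simp: A_set_def V_def)
    then show "v \<in> {k}"
      using a_gt[of v] f_less[of v] deg_clique[of v] deg_col[of v] by (cases v k rule: linorder_cases) auto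
  qed
  then have "clique (A_set V E) E" "indep (A_set V E) E" by (auto simp: clique_def indep_def)
  then have "NG1_graph V E" "NG2_graph V E" using NG by (auto simp: NG1_graph_def NG2_graph_def)
  then show ?thesis
    unfolding NG1_block_def NG2_block_def
    using seq \<open>alpha_of d = a\<close> \<open>beta_of d = b\<close> by blast
qed

section \<open>The amphora\<close>

lemma NG1_Int_NG2_eq_last_parts:
  assumes "0 < k"
  shows "NG1 n k \<inter> NG2 n k = {(a, b) \<in> A_blocks n k. 2 \<le> last a \<and> last b = 1}"
  using assms NG1_block_last_beta NG2_block_last_alpha NG_blocks_of_last_parts
  by (fastforce simp: NG1_def NG2_def)

theorem theorem4p24:
  fixes n k :: nat
  assumes "0 < n" and "0 < k" and "(k + 1) choose 2 \<le> n"
  shows "amphora (S_Block n) (\<lambda>X Y. block_majorizes Y X) (NG1 n k \<inter> NG2 n k) \<and>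
    NG1 n k \<inter> NG2 n k =
      {X \<in> S_Block n.
         block_majorizes X (tau k n, tau' k n) \<and>
         (\<exists>(a, b) \<in> S_Block n.
            a \<in> Dis_len k n \<and> b \<in> Dis_len k n \<and> last a \<ge> 2 \<and> last b = 1 \<and>
            covers_Dis n b a \<and> block_majorizes (a, b) X)}"
proof -
  define tops where "tops = {(a, b) \<in> S_Block n. a \<in> Dis_len k n \<and> b \<in> Dis_len k n \<and>
    2 \<le> last a \<and> last b = 1 \<and> covers_Dis n b a}"
  define bottom where "bottom = (tau k n, tau' k n)"
  have tau: "tau k n \<in> Dis n" "length (tau k n) = k" "tau' k n \<in> Dis n" "length (tau' k n) = k"
    using tau_in_Dis_len[OF assms(2,3)] tau'_in_Dis_len[OF assms(2,3)]
    by (auto simp: Dis_len_def)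
  have above_bottom: "block_majorizes (a, b) bottom"
    if "a \<in> Dis_len k n" "b \<in> Dis_len k n" for a b
    using that majorizes_tau[OF assms(2,3)] tau'_majorizes[OF assms(2,3)]
    by (simp add: block_majorizes_def bottom_def)

  have eq: "NG1 n k \<inter> NG2 n k =
    {X \<in> S_Block n. block_majorizes X bottom \<and> (\<exists>t\<in>tops. block_majorizes t X)}" (is "_ = ?R")
  proof
    show "NG1 n k \<inter> NG2 n k \<subseteq> ?R"
    proof
      fix X assume X: "X \<in> NG1 n k \<inter> NG2 n k"
      obtain a b where ab: "X = (a, b)" by fastforce
      have last: "2 \<le> last a" "last b = 1" and block: "(a, b) \<in> A_blocks n k"
        using X unfolding NG1_Int_NG2_eq_last_parts[OF assms(2)] ab by auto
      then have Dis: "a \<in> Dis n" "b \<in> Dis n" "length a = k" "length b = k" and maj: "majorizes b a"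
        and S: "(a, b) \<in> S_Block n"
        by (auto simp: A_blocks_def S_Block_def Dis_len_def)
      obtain a' b' where c: "majorizes a' a" "majorizes b b'" "2 \<le> last a'" "\<not> 2 \<le> last b'"
        "covers_Dis n b' a'"
        using cover_leaving_property[of a n b "\<lambda>g. 2 \<le> last g"] Dis maj last by auto
      then have Dis': "a' \<in> Dis n" "b' \<in> Dis n" "majorizes b' a'" by (auto simp: covers_Dis_def)
      \<comment> \<open>Lengths decrease along the order, so all four partitions have \<open>k\<close> parts.\<close>
      have "length b \<le> length b'" "length b' \<le> length a'" "length a' \<le> length a"
        using majorizes_length_le Dis Dis' c by blast+
      then have len: "length a' = k" "length b' = k" using Dis by auto
      have "last b' \<in> set b'" using len assms(2) by (intro last_in_set) auto
      then have "last b' = 1" using c(4) Dis'(2) by (force simp: Dis_def)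
      then have "(a', b') \<in> tops" using c Dis' len by (auto simp: tops_def S_Block_def Dis_len_def)
      moreover have "block_majorizes (a', b') X" using c by (simp add: block_majorizes_def ab)
      ultimately show "X \<in> ?R"
        using S above_bottom[of a b] Dis by (auto simp: ab Dis_len_def)
    qed
    show "?R \<subseteq> NG1 n k \<inter> NG2 n k"
    proof
      fix X assume X: "X \<in> ?R"
      obtain a b where ab: "X = (a, b)" by fastforce
      obtain a' b' where top: "(a', b') \<in> tops" and maj: "block_majorizes (a', b') (a, b)"
        using X ab by auto
      have S: "(a, b) \<in> S_Block n" using X ab by simp
      then have Dis: "a \<in> Dis n" "b \<in> Dis n" by (auto simp: S_Block_def)
      have top': "a' \<in> Dis n" "b' \<in> Dis n" "length a' = k" "length b' = k" "2 \<le> last a'" "last b' = 1"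
        using top by (auto simp: tops_def Dis_len_def)
      have m: "majorizes a' a" "majorizes b b'" "majorizes a (tau k n)" "majorizes (tau' k n) b"
        using maj X by (auto simp: ab block_majorizes_def bottom_def)
      have len: "length a = k" "length b = k"
        using majorizes_length_le[OF top'(1) Dis(1) m(1)] majorizes_length_le[OF Dis(2) top'(2) m(2)]
          majorizes_length_le[OF Dis(1) tau(1) m(3)] majorizes_length_le[OF tau(3) Dis(2) m(4)] top' tau
        by auto
      then have ne: "a' \<noteq> []" "b \<noteq> []" using top' assms(2) by auto
      have "2 \<le> last a"
        using majorizes_last_le[OF top'(1) Dis(1) m(1)] top' len ne by simp
      moreover have "last b \<le> 1"
        using majorizes_last_le[OF Dis(2) top'(2) m(2)] top' len ne by simp
      moreover have "0 < last b" using Dis(2) ne(2) by (auto simp: Dis_def)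
      ultimately show "X \<in> NG1 n k \<inter> NG2 n k"
        unfolding NG1_Int_NG2_eq_last_parts[OF assms(2)]
        using S Dis len by (auto simp: ab A_blocks_def Dis_len_def)
    qed
  qed

  \<comment> \<open>If one cover pair lay above another, both of its partitions would lie between those of the
    other and so be ends of that cover; the last parts determine which.\<close>
  have "antichain_in (S_Block n) (\<lambda>X Y. block_majorizes Y X) tops"
    unfolding antichain_in_def
  proof (intro conjI ballI impI)
    fix X Y assume "X \<in> tops" "Y \<in> tops" "block_majorizes Y X"
    then obtain a b c d where XY: "X = (a, b)" "Y = (c, d)"
      and cover: "covers_Dis n b a" "covers_Dis n d c"
      and last: "2 \<le> last a" "last b = 1" "2 \<le> last c" "last d = 1"
      and maj: "majorizes c a" "majorizes b d"
      by (auto simp: tops_def block_majorizes_def)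
    have Dis: "a \<in> Dis n" "b \<in> Dis n" "c \<in> Dis n" "d \<in> Dis n" "majorizes d c"
      using cover by (auto simp: covers_Dis_def)
    have "majorizes b c" "majorizes d a"
      using majorizes_trans[OF Dis(2,4,3) maj(2) Dis(5)] majorizes_trans[OF Dis(4,3,1) Dis(5) maj(1)]
      by auto
    then have "c = a \<or> c = b" "d = a \<or> d = b"
      using cover(1) Dis maj by (auto simp: covers_Dis_def)
    then show "X = Y" using last XY by auto
  qed (auto simp: tops_def)
  moreover have "bottom \<in> S_Block n"
    using tau tau'_majorizes[OF assms(2,3) tau_in_Dis_len[OF assms(2,3)]]
    by (simp add: bottom_def S_Block_def)
  moreover have "\<forall>t\<in>tops. block_majorizes t bottom"
    using above_bottom by (auto simp: tops_def)
  ultimately have "amphora (S_Block n) (\<lambda>X Y. block_majorizes Y X) (NG1 n k \<inter> NG2 n k)"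
    unfolding amphora_def using eq by blast
  moreover have "(\<exists>t\<in>tops. block_majorizes t X) \<longleftrightarrow>
      (\<exists>(a, b) \<in> S_Block n. a \<in> Dis_len k n \<and> b \<in> Dis_len k n \<and> last a \<ge> 2 \<and> last b = 1 \<and>
        covers_Dis n b a \<and> block_majorizes (a, b) X)" for X
    unfolding tops_def by blast
  ultimately show ?thesis using eq unfolding bottom_def by simp
qed

end
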